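(* Let $n\ge1$ and let $\omega(x_1,x_2,\dots,x_n)$ be an admissible word in the free group $F(x_1,\dots,x_n)$. If $G$ is a finite group, then the map $\zeta_n^{\omega}:G\to\mathbb{C}$ defined by $$\zeta_n^{\omega}(g)=|\{(g_1,g_2,\dots,g_n)\in G^n:\ \omega(g_1,g_2,\dots,g_n)=g\}|,\quad g\in G,$$ is a character of $G$.
   Context: $F(x_1,\dots,x_n)$ is the free group of words on $n$ generators $x_1,\dots,x_n$. One writes $x_i\in\omega$ if $x_i$ has a non-zero index in the word $\omega$ (that is, some $x_i^k$ with $0\ne k\in\mathbb{Z}$ forms a syllable of $\omega$). A word $\omega$ is called admissible if each $x_i\in\omega$ has precisely two non-zero indices in $\omega$, namely $+1$ and $-1$ (so each generator that occurs in $\omega$ occurs exactly once as $x_i$ and exactly once as $x_i^{-1}$). "Character" means the character of a finite-dimensional complex representation of $G$. $G^n=G\times\cdots\times G$ ($n$ times). *)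

theory Defs
  imports Jordan_Normal_Form.Matrix "HOL-Algebra.Group" "HOL-Library.Multiset"
begin

text \<open>
  A pair \<open>(i, k)\<close> stands for the syllable \<open>x\<^sub>i\<^sup>k\<close>. An element of the free group on
  \<open>x\<^sub>1, \<dots>, x\<^sub>n\<close> is represented by its unique normal form as a product of syllables: all
  exponents are nonzero and neighbouring syllables belong to different generators. The empty
  list is the identity element.
\<close>

type_synonym syllable_word = "(nat \<times> int) list"

definition free_group_words :: "nat \<Rightarrow> syllable_word set" where
  "free_group_words n =
     {w. (\<forall>(i, k) \<in> set w. i \<in> {1..n} \<and> k \<noteq> 0) \<and> distinct_adj (map fst w)}"

definition occurs_in :: "nat \<Rightarrow> syllable_word \<Rightarrow> bool" where
  "occurs_in i w \<longleftrightarrow> (\<exists>k. k \<noteq> 0 \<and> (i, k) \<in> set w)"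

text \<open>The indices of a generator are collected with multiplicity.\<close>

definition indices_in :: "nat \<Rightarrow> syllable_word \<Rightarrow> int multiset" where
  "indices_in i w = mset (map snd (filter (\<lambda>s. fst s = i) w))"

definition admissible :: "syllable_word \<Rightarrow> bool" where
  "admissible w \<longleftrightarrow> (\<forall>i. occurs_in i w \<longrightarrow> indices_in i w = {#1, -1#})"

text \<open>The value \<open>\<omega>(g\<^sub>1, \<dots>, g\<^sub>n)\<close>, with the factors multiplied from left to right.\<close>

definition word_value :: "('a, 'b) monoid_scheme \<Rightarrow> (nat \<Rightarrow> 'a) \<Rightarrow> syllable_word \<Rightarrow> 'a" where
  "word_value G g w = foldr (\<lambda>(i, k) y. (g i [^]\<^bsub>G\<^esub> k) \<otimes>\<^bsub>G\<^esub> y) w \<one>\<^bsub>G\<^esub>"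

definition zeta :: "('a, 'b) monoid_scheme \<Rightarrow> nat \<Rightarrow> syllable_word \<Rightarrow> 'a \<Rightarrow> complex" where
  "zeta G n w h = of_nat (card {g \<in> {1..n} \<rightarrow>\<^sub>E carrier G. word_value G g w = h})"

definition general_linear_group :: "nat \<Rightarrow> complex mat monoid" where
  "general_linear_group d = units_of (ring_mat TYPE(complex) d ())"

definition mat_trace :: "complex mat \<Rightarrow> complex" where
  "mat_trace A = (\<Sum>i<dim_row A. A $$ (i, i))"

text \<open>
  Representations are matrix representations of some degree \<open>d\<close>. Only the values of a function
  on the carrier matter. Degree \<open>0\<close> is not excluded, so the zero function counts as a
  character; a function that is nonzero at the identity can only come from \<open>d > 0\<close>.
\<close>

definition is_character :: "('a, 'b) monoid_scheme \<Rightarrow> ('a \<Rightarrow> complex) \<Rightarrow> bool" where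
  "is_character G \<chi> \<longleftrightarrow>
     (\<exists>d. \<exists>\<rho> \<in> hom G (general_linear_group d). \<forall>g \<in> carrier G. \<chi> g = mat_trace (\<rho> g))"

end

theory Submission
  imports Defs "Jordan_Normal_Form.Spectral_Radius"
begin

text \<open>
  Let \<open>N = |G|\<close> and let \<open>\<chi>\<close> be a simple (that is, irreducible) character. Schur's lemma, applied to averages
  over the group, gives for all \<open>u\<close> and \<open>v\<close>
    \<open>\<Sum>\<^sub>x \<chi>(u x v x\<inverse>) = N / \<chi>(1) \<cdot> \<chi>(u) \<chi>(v)\<close>  and  \<open>\<Sum>\<^sub>x \<chi>(u x) \<chi>(x\<inverse> v) = N / \<chi>(1) \<cdot> \<chi>(u v)\<close>.
  In an admissible word every generator that occurs does so once with exponent \<open>1\<close> and once with exponent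
  \<open>-1\<close>. So the generators can be summed out one at a time by these two identities, splitting and merging
  words, which yields (\<open>word_char_sum\<close>)
    \<open>\<Sum>\<^sub>g \<chi>(h \<omega>(g)) = N\<^sup>n \<chi>(1)\<^sup>v / \<chi>(1)\<^sup>a \<cdot> \<chi>(h)\<close>
  for some \<open>a \<le> n\<close> and some natural number \<open>v\<close>.

  The regular character \<open>\<Sum>\<^sub>\<chi> \<chi>(1) \<chi>\<close> is \<open>N\<close> times the indicator of the identity
  (\<open>regular_character_decomposition\<close>). Evaluating it at \<open>h\<inverse> \<omega>(g)\<close> and summing over \<open>g\<close> expresses \<open>\<zeta>(h)\<close> as
  a combination of the values \<open>\<chi>(h\<inverse>)\<close> with coefficients \<open>N\<^sup>n\<^sup>-\<^sup>1 \<chi>(1)\<^sup>v\<^sup>+\<^sup>1 / \<chi>(1)\<^sup>a\<close>. Since \<open>h \<mapsto> \<chi>(h\<inverse>)\<close> is the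
  character of the dual representation, it remains to see that these coefficients are natural numbers,
  which follows from \<open>a \<le> n\<close> once \<open>\<chi>(1)\<close> divides \<open>N\<close>.

  The divisibility (\<open>simple_char_degree_dvd\<close>) comes from the two identities as well: applied to commutators
  they show that \<open>(N / \<chi>(1))\<^sup>2\<close> is an eigenvalue of an integer matrix, and a rational eigenvalue of an integer
  matrix is an integer.
\<close>

section \<open>Matrices\<close>

lemma index_mult_mat_sum:
  assumes "A \<in> carrier_mat n m" "B \<in> carrier_mat m p" "i < n" "j < p"
  shows "(A * B) $$ (i, j) = (\<Sum>k<m. A $$ (i, k) * B $$ (k, j))"
  using assms by (auto simp: scalar_prod_def atLeast0LessThan)

lemma mat_trace_carrier: "A \<in> carrier_mat d d \<Longrightarrow> mat_trace A = (\<Sum>i<d. A $$ (i, i))"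
  by (auto simp: mat_trace_def)

lemma mat_trace_mult_comm:
  assumes "A \<in> carrier_mat d e" "B \<in> carrier_mat e d"
  shows "mat_trace (A * B) = mat_trace (B * A)"
proof -
  have "mat_trace (A * B) = (\<Sum>i<d. \<Sum>k<e. A $$ (i, k) * B $$ (k, i))"
    using assms by (subst mat_trace_carrier[of _ d]) (auto simp: index_mult_mat_sum simp del: index_mult_mat)
  also have "\<dots> = (\<Sum>k<e. \<Sum>i<d. B $$ (k, i) * A $$ (i, k))"
    by (subst sum.swap) (simp add: mult.commute)
  also have "\<dots> = mat_trace (B * A)"
    using assms by (subst mat_trace_carrier[of _ e]) (auto simp: index_mult_mat_sum simp del: index_mult_mat)
  finally show ?thesis .
qed

lemma mat_trace_smult: "mat_trace (c \<cdot>\<^sub>m A) = c * mat_trace A" if "A \<in> carrier_mat d d"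
  using that by (auto simp: mat_trace_def sum_distrib_left)

lemma mult_scalar_mat:
  fixes A :: "complex mat"
  assumes "A \<in> carrier_mat c d"
  shows "A * (k \<cdot>\<^sub>m 1\<^sub>m d) = k \<cdot>\<^sub>m A" and "(k \<cdot>\<^sub>m 1\<^sub>m c) * A = k \<cdot>\<^sub>m A"
  unfolding mult_smult_distrib[OF assms one_carrier_mat] mult_smult_assoc_mat[OF one_carrier_mat assms]
    right_mult_one_mat[OF assms] left_mult_one_mat[OF assms] by (rule refl)+

lemma sum_lessThan_add: "(\<Sum>i<m + (n::nat). f i) = (\<Sum>i<m. f i) + (\<Sum>i<n. f (m + i))"
  for f :: "nat \<Rightarrow> complex"
  by (induction n) (simp_all add: add.assoc)

lemma mat_trace_one: "mat_trace (1\<^sub>m d) = of_nat d"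
  by (simp add: mat_trace_def)

text \<open>
  The sum of a family of \<open>d \<times> e\<close> matrices, formed entrywise. Fixing the format in advance makes
  the empty sum the zero matrix of the right size.
\<close>

definition mat_of_sums :: "nat \<Rightarrow> nat \<Rightarrow> ('i \<Rightarrow> complex mat) \<Rightarrow> 'i set \<Rightarrow> complex mat" where
  "mat_of_sums d e F S = mat d e (\<lambda>ij. \<Sum>x\<in>S. F x $$ ij)"

lemma mat_of_sums_carrier [simp]: "mat_of_sums d e F S \<in> carrier_mat d e"
  by (simp add: mat_of_sums_def)

lemma mat_of_sums_cong: "(\<And>x. x \<in> S \<Longrightarrow> F x = F' x) \<Longrightarrow> mat_of_sums d e F S = mat_of_sums d e F' S"
  unfolding mat_of_sums_def by (intro eq_matI) auto

lemma mult_mat_of_sums_left: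
  assumes "A \<in> carrier_mat c d" "\<And>x. x \<in> S \<Longrightarrow> F x \<in> carrier_mat d e"
  shows "A * mat_of_sums d e F S = mat_of_sums c e (\<lambda>x. A * F x) S"
proof (rule eq_matI)
  fix i j assume ij: "i < dim_row (mat_of_sums c e (\<lambda>x. A * F x) S)" "j < dim_col (mat_of_sums c e (\<lambda>x. A * F x) S)"
  hence ij': "i < c" "j < e" by (auto simp: mat_of_sums_def)
  have "(A * mat_of_sums d e F S) $$ (i, j) = (\<Sum>k<d. A $$ (i, k) * (\<Sum>x\<in>S. F x $$ (k, j)))"
    using assms ij' by (subst index_mult_mat_sum[of _ c d _ e]) (auto simp: mat_of_sums_def)
  also have "\<dots> = (\<Sum>x\<in>S. \<Sum>k<d. A $$ (i, k) * F x $$ (k, j))"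
    by (subst sum.swap) (simp add: sum_distrib_left)
  also have "\<dots> = (\<Sum>x\<in>S. (A * F x) $$ (i, j))"
    using assms ij' by (intro sum.cong refl index_mult_mat_sum[symmetric]) auto
  finally show "(A * mat_of_sums d e F S) $$ (i, j) = mat_of_sums c e (\<lambda>x. A * F x) S $$ (i, j)"
    using ij' by (simp add: mat_of_sums_def)
qed (use assms in \<open>auto simp: mat_of_sums_def\<close>)

lemma mult_mat_of_sums_right:
  assumes "A \<in> carrier_mat e c" "\<And>x. x \<in> S \<Longrightarrow> F x \<in> carrier_mat d e"
  shows "mat_of_sums d e F S * A = mat_of_sums d c (\<lambda>x. F x * A) S"
proof (rule eq_matI)
  fix i j assume ij: "i < dim_row (mat_of_sums d c (\<lambda>x. F x * A) S)" "j < dim_col (mat_of_sums d c (\<lambda>x. F x * A) S)"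
  hence ij': "i < d" "j < c" by (auto simp: mat_of_sums_def)
  have "(mat_of_sums d e F S * A) $$ (i, j) = (\<Sum>k<e. (\<Sum>x\<in>S. F x $$ (i, k)) * A $$ (k, j))"
    using assms ij' by (subst index_mult_mat_sum[of _ d e _ c]) (auto simp: mat_of_sums_def)
  also have "\<dots> = (\<Sum>x\<in>S. \<Sum>k<e. F x $$ (i, k) * A $$ (k, j))"
    by (subst sum.swap) (simp add: sum_distrib_right)
  also have "\<dots> = (\<Sum>x\<in>S. (F x * A) $$ (i, j))"
    using assms ij' by (intro sum.cong refl index_mult_mat_sum[symmetric]) auto
  finally show "(mat_of_sums d e F S * A) $$ (i, j) = mat_of_sums d c (\<lambda>x. F x * A) S $$ (i, j)"
    using ij' by (simp add: mat_of_sums_def)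
qed (use assms in \<open>auto simp: mat_of_sums_def\<close>)

lemma mat_trace_mat_of_sums:
  assumes "\<And>x. x \<in> S \<Longrightarrow> F x \<in> carrier_mat d d"
  shows "mat_trace (mat_of_sums d d F S) = (\<Sum>x\<in>S. mat_trace (F x))"
proof -
  have "mat_trace (mat_of_sums d d F S) = (\<Sum>i<d. \<Sum>x\<in>S. F x $$ (i, i))"
    by (subst mat_trace_carrier[of _ d]) (auto simp: mat_of_sums_def)
  also have "\<dots> = (\<Sum>x\<in>S. \<Sum>i<d. F x $$ (i, i))" by (rule sum.swap)
  also have "\<dots> = (\<Sum>x\<in>S. mat_trace (F x))"
    using assms by (intro sum.cong refl) (simp add: mat_trace_carrier[of _ d])
  finally show ?thesis .
qed

text \<open>
  The matrix unit with the single entry \<open>1\<close> at position \<open>(a, b)\<close>.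
\<close>

definition elem_mat :: "nat \<Rightarrow> nat \<Rightarrow> nat \<Rightarrow> nat \<Rightarrow> complex mat" where
  "elem_mat d e a b = mat d e (\<lambda>(i, j). if i = a \<and> j = b then 1 else 0)"

lemma elem_mat_carrier [simp]: "elem_mat d e a b \<in> carrier_mat d e"
  by (simp add: elem_mat_def)

lemma mult_elem_mat_mult:
  assumes "A \<in> carrier_mat c d" "B \<in> carrier_mat e f" "i < c" "j < f" "a < d" "b < e"
  shows "(A * elem_mat d e a b * B) $$ (i, j) = A $$ (i, a) * B $$ (b, j)"
proof -
  have 1: "(A * elem_mat d e a b) $$ (i, k) = (if k = b then A $$ (i, a) else 0)" if "k < e" for k
    using assms that
    by (subst index_mult_mat_sum[of _ c d _ e])
       (auto simp: elem_mat_def if_distrib sum.delta cong: if_cong)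
  show ?thesis
    using assms
    by (subst index_mult_mat_sum[of _ c e _ f])
       (auto simp: 1 if_distrib[of "\<lambda>x. x * _"] sum.delta  simp del: index_mult_mat(1) cong: if_cong)
qed

lemma mat_trace_mult_elem_mat:
  assumes "A \<in> carrier_mat d e" "a < d" "b < e"
  shows "mat_trace (A * elem_mat e d b a) = A $$ (a, b)"
proof -
  have 1: "(A * elem_mat e d b a) $$ (i, i) = (if i = a then A $$ (i, b) else 0)" if "i < d" for i
    using assms that
    by (subst index_mult_mat_sum[of _ d e _ d])
       (auto simp: elem_mat_def if_distrib sum.delta cong: if_cong)
  show ?thesis using assms
    by (subst mat_trace_carrier[of _ d]) (auto simp: 1 sum.delta simp del: index_mult_mat(1))
qed

text \<open>
  Gauss--Jordan elimination of a singular nonzero matrix \<open>N\<close>: the reduced form \<open>P N\<close> has \<open>r\<close> nonzero rows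
  with \<open>0 < r < d\<close>, and for each \<open>j < r\<close> its column \<open>f j\<close> is the \<open>j\<close>-th unit vector.
\<close>

lemma singular_row_reduction:
  fixes N :: "complex mat"
  assumes N: "N \<in> carrier_mat d d" and nz: "N \<noteq> 0\<^sub>m d d"
    and v: "v \<in> carrier_vec d" "v \<noteq> 0\<^sub>v d" "N *\<^sub>v v = 0\<^sub>v d"
  obtains P Q r f where "P \<in> carrier_mat d d" "Q \<in> carrier_mat d d" "P * Q = 1\<^sub>m d" "Q * P = 1\<^sub>m d"
    and "0 < r" "r < d"
    and "\<And>i j. r \<le> i \<Longrightarrow> i < d \<Longrightarrow> j < d \<Longrightarrow> (P * N) $$ (i, j) = 0"
    and "\<And>i j. i < d \<Longrightarrow> j < r \<Longrightarrow> f j < d \<and> (P * N) $$ (i, f j) = (if i = j then 1 else 0)"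
proof -
  define C where "C = gauss_jordan_single N"
  note gj = gauss_jordan_single[OF N C_def[symmetric]]
  obtain P Q where PQ: "C = P * N" "P \<in> carrier_mat d d" "Q \<in> carrier_mat d d" "P * Q = 1\<^sub>m d" "Q * P = 1\<^sub>m d"
    using gj(4) by blast
  have C: "C \<in> carrier_mat d d" by (rule gj(2))
  hence dim: "dim_row C = d" "dim_col C = d" by auto
  obtain f where f: "pivot_fun C f d"
    using gj(3) dim unfolding row_echelon_form_def by auto
  note piv = pivot_funD[OF dim(1) f]
  have "C \<noteq> 1\<^sub>m d"
  proof
    assume "C = 1\<^sub>m d"
    hence "v = C *\<^sub>v v" using v by simp
    also have "\<dots> = 0\<^sub>v d" using gj(1)[OF v(1)] v(3) by simp
    finally show False using v by simp
  qed
  hence last: "d > 0" "row C (d - 1) = 0\<^sub>v d"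
    using row_echelon_form_imp_1_or_0_row[OF C gj(3)] by auto
  have zero_row: "f i = d \<longleftrightarrow> row C i = 0\<^sub>v d" if "i < d" for i
    using pivot_fun_zero_row_iff[OF f C that] .
  have ex: "f (d - 1) = d" using zero_row[of "d - 1"] last by simp
  \<comment> \<open>A pivot position \<open>d\<close> marks a zero row, so \<open>r\<close> counts the nonzero rows.\<close>
  define r where "r = (LEAST i. f i = d)"
  have fr: "f r = d" unfolding r_def using ex by (rule LeastI)
  have r_le: "r \<le> d - 1" unfolding r_def using ex by (rule Least_le)
  have below: "f j < d" if "j < r" for j
  proof -
    have "f j \<noteq> d" using that unfolding r_def by (rule not_less_Least)
    moreover have "f j \<le> d" using piv(1)[of j] that r_le by simp
    ultimately show ?thesis by simp
  qed
  have above: "f i = d" if "r \<le> i" "i < d" for i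
    using that
  proof (induction i rule: dec_induct)
    case (step i)
    thus ?case using piv(3)[of i] piv(1)[of "Suc i"] by auto
  qed (rule fr)
  have zero: "C $$ (i, j) = 0" if "r \<le> i" "i < d" "j < d" for i j
    using piv(2)[of i j] above[of i] that by simp
  have "r \<noteq> 0"
  proof
    assume "r = 0"
    hence "C = 0\<^sub>m d d" using zero C by (intro eq_matI) auto
    hence "Q * C = 0\<^sub>m d d" using PQ(3) by simp
    moreover have "Q * C = Q * P * N" unfolding PQ(1) using PQ N by (intro assoc_mult_mat[symmetric]) auto
    ultimately show False using PQ(5) N nz by simp
  qed
  show thesis
  proof (rule that[OF PQ(2-5)])
    show "0 < r" "r < d" using \<open>r \<noteq> 0\<close> r_le last(1) by auto
    show "(P * N) $$ (i, j) = 0" if "r \<le> i" "i < d" "j < d" for i j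
      using zero[OF that] PQ(1) by simp
    show "f j < d \<and> (P * N) $$ (i, f j) = (if i = j then 1 else 0)" if "i < d" "j < r" for i j
      using that below[of j] piv(4)[of j] piv(5)[of j i] r_le unfolding PQ(1)[symmetric] by auto
  qed
qed

text \<open>
  The characteristic polynomial of an integer matrix is monic with integer coefficients, so its
  rational roots are integers.
\<close>

lemma rational_eigenvalue_of_int_mat:
  fixes A :: "int mat" and k :: complex
  assumes A: "A \<in> carrier_mat n n" and ev: "eigenvalue (map_mat of_int A) k" and k: "k \<in> \<rat>"
  shows "k \<in> \<int>"
proof (rule rational_algebraic_int_is_int)
  define B :: "complex mat" where "B = map_mat of_int A"
  have B: "B \<in> carrier_mat n n" using A by (simp add: B_def)
  have "poly (char_poly B) k = 0"
    using ev eigenvalue_root_char_poly[OF B] by (simp add: B_def)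
  moreover have "char_poly B = map_poly of_int (char_poly A)"
    unfolding B_def by (rule of_int_hom.char_poly_hom[OF A])
  moreover have "lead_coeff (char_poly B) = 1"
    using degree_monic_char_poly[OF B] by simp
  ultimately show "algebraic_int k"
    by (intro algebraic_int.intros[of "char_poly B"]) (auto simp: coeff_map_poly)
qed (fact k)

lemma sum_list_map_conv_sum_set:
  fixes f :: "'i \<Rightarrow> 'k :: semiring_1"
  shows "(\<Sum>x\<leftarrow>xs. f x) = (\<Sum>x\<in>set xs. of_nat (count_list xs x) * f x)"
proof (induction xs)
  case (Cons a xs)
  have "(\<Sum>x\<in>set (a # xs). of_nat (count_list (a # xs) x) * f x) =
        (\<Sum>x\<in>set (a # xs). (if x = a then f x else 0) + of_nat (count_list xs x) * f x)"
    by (intro sum.cong refl) (auto simp: algebra_simps)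
  also have "\<dots> = f a + (\<Sum>x\<in>set (a # xs). of_nat (count_list xs x) * f x)"
    by (simp add: sum.distrib)
  also have "(\<Sum>x\<in>set (a # xs). of_nat (count_list xs x) * f x) =
        (\<Sum>x\<in>set xs. of_nat (count_list xs x) * f x)"
    by (intro sum.mono_neutral_right) (auto simp: count_list_0_iff)
  finally show ?case using Cons by simp
qed simp

section \<open>Matrix representations and their characters\<close>

locale finite_group = group G for G :: "('a, 'b) monoid_scheme" (structure) +
  assumes finite_carrier: "finite (carrier G)"
begin

text \<open>
  A matrix representation of degree \<open>d\<close>. With \<open>\<rho> \<one> = 1\<close> as an axiom, the matrices are invertible
  without further ado, so these are exactly the homomorphisms into the general linear group.
\<close>

definition is_rep :: "nat \<Rightarrow> ('a \<Rightarrow> complex mat) \<Rightarrow> bool" where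
  "is_rep d \<rho> \<longleftrightarrow> (\<forall>g\<in>carrier G. \<rho> g \<in> carrier_mat d d) \<and>
     (\<forall>g\<in>carrier G. \<forall>h\<in>carrier G. \<rho> (g \<otimes> h) = \<rho> g * \<rho> h) \<and> \<rho> \<one> = 1\<^sub>m d"

text \<open>
  Simplicity is defined by what Schur's lemma gives for an irreducible complex representation: the
  matrices commuting with the whole image are the scalars. Degree \<open>0\<close> is excluded.
\<close>

definition simple_rep :: "nat \<Rightarrow> ('a \<Rightarrow> complex mat) \<Rightarrow> bool" where
  "simple_rep d \<rho> \<longleftrightarrow> is_rep d \<rho> \<and> d > 0 \<and>
     (\<forall>T\<in>carrier_mat d d. (\<forall>x\<in>carrier G. \<rho> x * T = T * \<rho> x) \<longrightarrow> (\<exists>c. T = c \<cdot>\<^sub>m 1\<^sub>m d))"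

lemma is_repD:
  assumes "is_rep d \<rho>"
  shows "g \<in> carrier G \<Longrightarrow> \<rho> g \<in> carrier_mat d d"
    and "g \<in> carrier G \<Longrightarrow> h \<in> carrier G \<Longrightarrow> \<rho> (g \<otimes> h) = \<rho> g * \<rho> h"
    and "\<rho> \<one> = 1\<^sub>m d"
    and "g \<in> carrier G \<Longrightarrow> \<rho> g * \<rho> (inv g) = 1\<^sub>m d"
    and "g \<in> carrier G \<Longrightarrow> \<rho> (inv g) * \<rho> g = 1\<^sub>m d"
  using assms unfolding is_rep_def by (auto, (metis inv_closed r_inv l_inv)+)

lemma simple_repD:
  assumes "simple_rep d \<rho>" "T \<in> carrier_mat d d" "\<And>x. x \<in> carrier G \<Longrightarrow> \<rho> x * T = T * \<rho> x"
  shows "\<exists>c. T = c \<cdot>\<^sub>m 1\<^sub>m d"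
  using assms by (simp add: simple_rep_def)

lemma is_character_iff:
  "is_character G \<chi> \<longleftrightarrow> (\<exists>d \<rho>. is_rep d \<rho> \<and> (\<forall>g\<in>carrier G. \<chi> g = mat_trace (\<rho> g)))"
proof
  assume "is_character G \<chi>"
  then obtain d \<rho> where \<rho>: "\<rho> \<in> hom G (general_linear_group d)"
    and \<chi>: "\<forall>g\<in>carrier G. \<chi> g = mat_trace (\<rho> g)"
    unfolding is_character_def by blast
  interpret R: ring "ring_mat TYPE(complex) d ()" by (rule ring_mat)
  interpret U: group "general_linear_group d"
    unfolding general_linear_group_def by (rule R.units_group)
  have "\<rho> \<one> = 1\<^sub>m d"
    using hom_one[OF \<rho> is_group U.is_group]
    by (simp add: general_linear_group_def units_of_def ring_mat_simps)
  with \<rho> have "is_rep d \<rho>"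
    by (auto simp: is_rep_def hom_def general_linear_group_def units_of_def ring_mat_simps Units_def Pi_def)
  with \<chi> show "\<exists>d \<rho>. is_rep d \<rho> \<and> (\<forall>g\<in>carrier G. \<chi> g = mat_trace (\<rho> g))" by blast
next
  assume "\<exists>d \<rho>. is_rep d \<rho> \<and> (\<forall>g\<in>carrier G. \<chi> g = mat_trace (\<rho> g))"
  then obtain d \<rho> where \<rho>: "is_rep d \<rho>" and \<chi>: "\<forall>g\<in>carrier G. \<chi> g = mat_trace (\<rho> g)" by blast
  have "\<rho> \<in> hom G (general_linear_group d)"
    using is_repD[OF \<rho>] inv_closed
    by (auto simp: hom_def general_linear_group_def units_of_def ring_mat_simps Units_def Pi_def)
       blast
  with \<chi> show "is_character G \<chi>" unfolding is_character_def by blast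
qed

lemma is_character_zero: "is_character G (\<lambda>_. 0)"
proof -
  have "is_rep 0 (\<lambda>_. 1\<^sub>m 0)" by (auto simp: is_rep_def)
  thus ?thesis unfolding is_character_iff by (intro exI[of _ 0] exI[of _ "\<lambda>_. 1\<^sub>m 0"]) (auto simp: mat_trace_def)
qed

lemma is_character_add:
  assumes "is_character G \<chi>" "is_character G \<psi>"
  shows "is_character G (\<lambda>g. \<chi> g + \<psi> g)"
proof -
  obtain d \<rho> e \<sigma> where \<rho>: "is_rep d \<rho>" "\<forall>g\<in>carrier G. \<chi> g = mat_trace (\<rho> g)"
    and \<sigma>: "is_rep e \<sigma>" "\<forall>g\<in>carrier G. \<psi> g = mat_trace (\<sigma> g)"
    using assms unfolding is_character_iff by blast
  define \<tau> where "\<tau> g = four_block_mat (\<rho> g) (0\<^sub>m d e) (0\<^sub>m e d) (\<sigma> g)" for g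
  have "is_rep (d + e) \<tau>"
    unfolding is_rep_def
  proof (intro conjI ballI)
    fix g h assume gh: "g \<in> carrier G" "h \<in> carrier G"
    have c: "\<rho> g \<in> carrier_mat d d" "\<rho> h \<in> carrier_mat d d" "\<sigma> g \<in> carrier_mat e e" "\<sigma> h \<in> carrier_mat e e"
      using is_repD(1)[OF \<rho>(1)] is_repD(1)[OF \<sigma>(1)] gh by auto
    have "\<tau> g * \<tau> h = four_block_mat (\<rho> g * \<rho> h) (0\<^sub>m d e) (0\<^sub>m e d) (\<sigma> g * \<sigma> h)"
      unfolding \<tau>_def using c
      by (subst mult_four_block_mat[OF c(1) zero_carrier_mat zero_carrier_mat c(3)
            c(2) zero_carrier_mat zero_carrier_mat c(4)]) simp
    thus "\<tau> (g \<otimes> h) = \<tau> g * \<tau> h"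
      using is_repD(2)[OF \<rho>(1) gh] is_repD(2)[OF \<sigma>(1) gh] by (simp add: \<tau>_def)
  qed (use is_repD[OF \<rho>(1)] is_repD[OF \<sigma>(1)] in \<open>auto simp: \<tau>_def\<close>)
  moreover have "\<chi> g + \<psi> g = mat_trace (\<tau> g)" if "g \<in> carrier G" for g
  proof -
    have c: "\<rho> g \<in> carrier_mat d d" "\<sigma> g \<in> carrier_mat e e"
      using is_repD[OF \<rho>(1)] is_repD[OF \<sigma>(1)] that by auto
    have "mat_trace (\<tau> g) = (\<Sum>i<d + e. \<tau> g $$ (i, i))"
      using c by (intro mat_trace_carrier) (auto simp: \<tau>_def)
    also have "\<dots> = (\<Sum>i<d. \<tau> g $$ (i, i)) + (\<Sum>i<e. \<tau> g $$ (d + i, d + i))"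
      by (rule sum_lessThan_add[of "\<lambda>i. \<tau> g $$ (i, i)"])
    also have "\<dots> = mat_trace (\<rho> g) + mat_trace (\<sigma> g)"
      using c by (auto simp: \<tau>_def mat_trace_def)
    finally show ?thesis using \<rho>(2) \<sigma>(2) that by simp
  qed
  ultimately show ?thesis unfolding is_character_iff by blast
qed

lemma is_character_cong:
  "(\<And>g. g \<in> carrier G \<Longrightarrow> \<chi> g = \<psi> g) \<Longrightarrow> is_character G \<chi> = is_character G \<psi>"
  by (simp add: is_character_def)

lemma is_character_of_nat_mult:
  assumes "is_character G \<chi>"
  shows "is_character G (\<lambda>g. of_nat k * \<chi> g)"
proof (induction k)
  case (Suc k)
  from is_character_add[OF assms Suc] show ?case by (simp add: algebra_simps)
qed (simp add: is_character_zero)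

lemma is_character_sum:
  assumes "\<And>i. i \<in> S \<Longrightarrow> is_character G (\<chi> i)"
  shows "is_character G (\<lambda>g. \<Sum>i\<in>S. \<chi> i g)"
  using assms
  by (induction S rule: infinite_finite_induct) (simp_all add: is_character_zero is_character_add)

text \<open>
  The character of the dual representation.
\<close>

lemma is_character_inv:
  assumes "is_character G \<chi>"
  shows "is_character G (\<lambda>g. \<chi> (inv g))"
proof -
  obtain d \<rho> where \<rho>: "is_rep d \<rho>" "\<forall>g\<in>carrier G. \<chi> g = mat_trace (\<rho> g)"
    using assms unfolding is_character_iff by blast
  have "is_rep d (\<lambda>g. transpose_mat (\<rho> (inv g)))"
    unfolding is_rep_def
  proof (intro conjI ballI)
    fix g h assume gh: "g \<in> carrier G" "h \<in> carrier G"
    show "transpose_mat (\<rho> (inv (g \<otimes> h))) = transpose_mat (\<rho> (inv g)) * transpose_mat (\<rho> (inv h))"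
      using gh is_repD(1,2)[OF \<rho>(1)]
      by (simp add: inv_mult_group transpose_mult[OF is_repD(1)[OF \<rho>(1)] is_repD(1)[OF \<rho>(1)]])
  qed (use is_repD(1,3)[OF \<rho>(1)] in auto)
  moreover have "\<chi> (inv g) = mat_trace (transpose_mat (\<rho> (inv g)))" if "g \<in> carrier G" for g
    using \<rho> is_repD(1)[OF \<rho>(1), of "inv g"] that by (auto simp: mat_trace_def)
  ultimately show ?thesis unfolding is_character_iff by blast
qed

section \<open>Averaging over the group and Schur's relations\<close>

lemma bij_mult_left: "y \<in> carrier G \<Longrightarrow> bij_betw (\<lambda>x. y \<otimes> x) (carrier G) (carrier G)"
  by (intro bij_betwI[where g = "\<lambda>x. inv y \<otimes> x"]) (auto simp: m_assoc[symmetric])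

lemma sum_mult_left: "y \<in> carrier G \<Longrightarrow> (\<Sum>x\<in>carrier G. f (y \<otimes> x)) = (\<Sum>x\<in>carrier G. f x)"
  using sum.reindex_bij_betw[OF bij_mult_left] .

text \<open>
  The average \<open>\<Sum>\<^sub>x \<rho>(x) A \<sigma>(x)\<inverse>\<close>, without the factor \<open>1 / |G|\<close>. It turns any matrix \<open>A\<close> into one
  that intertwines \<open>\<rho>\<close> and \<open>\<sigma>\<close>.
\<close>

definition averaged :: "nat \<Rightarrow> ('a \<Rightarrow> complex mat) \<Rightarrow> nat \<Rightarrow> ('a \<Rightarrow> complex mat) \<Rightarrow> complex mat \<Rightarrow> complex mat" where
  "averaged d \<rho> e \<sigma> A = mat_of_sums d e (\<lambda>x. \<rho> x * A * \<sigma> (inv x)) (carrier G)"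

lemma averaged_carrier [simp]: "averaged d \<rho> e \<sigma> A \<in> carrier_mat d e"
  by (simp add: averaged_def)

lemma averaged_intertwines:
  assumes \<rho>: "is_rep d \<rho>" and \<sigma>: "is_rep e \<sigma>" and A: "A \<in> carrier_mat d e" and y: "y \<in> carrier G"
  shows "\<rho> y * averaged d \<rho> e \<sigma> A = averaged d \<rho> e \<sigma> A * \<sigma> y"
proof -
  note r = is_repD[OF \<rho>] and s = is_repD[OF \<sigma>]
  have c: "\<rho> x * A * \<sigma> (inv x) \<in> carrier_mat d e" if "x \<in> carrier G" for x
    using r(1) s(1) A that by (meson inv_closed mult_carrier_mat)
  have eq: "\<rho> y * (\<rho> x * A * \<sigma> (inv x)) = \<rho> (y \<otimes> x) * A * \<sigma> (inv (y \<otimes> x)) * \<sigma> y"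
    if x: "x \<in> carrier G" for x
  proof -
    have cs: "\<rho> y \<in> carrier_mat d d" "\<rho> x \<in> carrier_mat d d" "\<sigma> y \<in> carrier_mat e e"
      "\<sigma> (inv x) \<in> carrier_mat e e" "\<sigma> (inv y) \<in> carrier_mat e e"
      using r(1) s(1) x y by auto
    have "\<sigma> (inv (y \<otimes> x)) * \<sigma> y = \<sigma> (inv x)"
      using x y s(2)[of "inv (y \<otimes> x)" y] by (simp add: inv_mult_group m_assoc)
    moreover have "\<rho> (y \<otimes> x) * A * \<sigma> (inv (y \<otimes> x)) * \<sigma> y = \<rho> (y \<otimes> x) * A * (\<sigma> (inv (y \<otimes> x)) * \<sigma> y)"
      using x y r(1)[of "y \<otimes> x"] s(1)[of "inv (y \<otimes> x)"] cs A by (intro assoc_mult_mat) auto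
    ultimately have "\<rho> (y \<otimes> x) * A * \<sigma> (inv (y \<otimes> x)) * \<sigma> y = \<rho> y * \<rho> x * A * \<sigma> (inv x)"
      using x y r(2) by simp
    also have "\<dots> = \<rho> y * (\<rho> x * A * \<sigma> (inv x))"
      using cs A by (simp add: assoc_mult_mat[of _ d d _ d _ e] assoc_mult_mat[of _ d d _ e _ e])
    finally show ?thesis by simp
  qed
  have "\<rho> y * averaged d \<rho> e \<sigma> A = mat_of_sums d e (\<lambda>x. \<rho> y * (\<rho> x * A * \<sigma> (inv x))) (carrier G)"
    unfolding averaged_def using r(1) y c by (intro mult_mat_of_sums_left) auto
  also have "\<dots> = mat_of_sums d e (\<lambda>x. \<rho> (y \<otimes> x) * A * \<sigma> (inv (y \<otimes> x)) * \<sigma> y) (carrier G)"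
    by (intro mat_of_sums_cong eq)
  also have "\<dots> = mat_of_sums d e (\<lambda>x. \<rho> x * A * \<sigma> (inv x) * \<sigma> y) (carrier G)"
    unfolding mat_of_sums_def using sum_mult_left[OF y, of "\<lambda>x. (\<rho> x * A * \<sigma> (inv x) * \<sigma> y) $$ ij" for ij]
    by simp
  also have "\<dots> = averaged d \<rho> e \<sigma> A * \<sigma> y"
    unfolding averaged_def using s(1) y c by (intro mult_mat_of_sums_right[symmetric]) auto
  finally show ?thesis .
qed

lemma mat_trace_averaged_mult:
  assumes \<rho>: "is_rep d \<rho>" and \<sigma>: "is_rep e \<sigma>" and A: "A \<in> carrier_mat d e"
    and T: "T \<in> carrier_mat e d" and comm: "\<And>x. x \<in> carrier G \<Longrightarrow> \<sigma> x * T = T * \<rho> x"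
  shows "mat_trace (T * averaged d \<rho> e \<sigma> A) = of_nat (card (carrier G)) * mat_trace (T * A)"
proof -
  note r = is_repD[OF \<rho>] and s = is_repD[OF \<sigma>]
  have c: "\<rho> x * A * \<sigma> (inv x) \<in> carrier_mat d e" if "x \<in> carrier G" for x
    using r(1) s(1) A that by (meson inv_closed mult_carrier_mat)
  have eq: "mat_trace (T * (\<rho> x * A * \<sigma> (inv x))) = mat_trace (T * A)" if x: "x \<in> carrier G" for x
  proof -
    have cs: "\<rho> x \<in> carrier_mat d d" "\<sigma> x \<in> carrier_mat e e" "\<sigma> (inv x) \<in> carrier_mat e e"
      using r(1) s(1) x by auto
    have "T * (\<rho> x * A * \<sigma> (inv x)) = T * (\<rho> x * A) * \<sigma> (inv x)"
      using cs A T by (intro assoc_mult_mat[symmetric]) auto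
    also have "T * (\<rho> x * A) = T * \<rho> x * A"
      using cs A T by (intro assoc_mult_mat[symmetric]) auto
    also have "T * \<rho> x * A = \<sigma> x * T * A" using comm x by simp
    also have "\<sigma> x * T * A = \<sigma> x * (T * A)" using cs A T by (intro assoc_mult_mat) auto
    also have "mat_trace (\<sigma> x * (T * A) * \<sigma> (inv x)) = mat_trace (\<sigma> (inv x) * (\<sigma> x * (T * A)))"
      using cs A T by (intro mat_trace_mult_comm[of _ e e]) auto
    also have "\<sigma> (inv x) * (\<sigma> x * (T * A)) = \<sigma> (inv x) * \<sigma> x * (T * A)"
      using cs A T by (intro assoc_mult_mat[symmetric]) auto
    also have "\<dots> = T * A" using s(5)[OF x] A T by simp
    finally show ?thesis .
  qed
  have "T * averaged d \<rho> e \<sigma> A = mat_of_sums e e (\<lambda>x. T * (\<rho> x * A * \<sigma> (inv x))) (carrier G)"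
    unfolding averaged_def using T c by (intro mult_mat_of_sums_left) auto
  hence "mat_trace (T * averaged d \<rho> e \<sigma> A) = (\<Sum>x\<in>carrier G. mat_trace (T * (\<rho> x * A * \<sigma> (inv x))))"
    using T c by (simp add: mat_trace_mat_of_sums mult_carrier_mat[OF T])
  also have "\<dots> = of_nat (card (carrier G)) * mat_trace (T * A)"
    using eq by simp
  finally show ?thesis .
qed

lemma averaged_simple:
  assumes \<rho>: "simple_rep d \<rho>" and A: "A \<in> carrier_mat d d"
  shows "averaged d \<rho> d \<rho> A = (of_nat (card (carrier G)) * mat_trace A / of_nat d) \<cdot>\<^sub>m 1\<^sub>m d"
proof -
  have rep: "is_rep d \<rho>" and d: "d > 0" using \<rho> by (auto simp: simple_rep_def)
  from simple_repD[OF \<rho> averaged_carrier averaged_intertwines[OF rep rep A]]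
  obtain c where c: "averaged d \<rho> d \<rho> A = c \<cdot>\<^sub>m 1\<^sub>m d" ..
  have "\<rho> x * 1\<^sub>m d = \<rho> x" "1\<^sub>m d * \<rho> x = \<rho> x" if "x \<in> carrier G" for x
    using is_repD(1)[OF rep that] by simp_all
  hence "mat_trace (1\<^sub>m d * averaged d \<rho> d \<rho> A) = of_nat (card (carrier G)) * mat_trace (1\<^sub>m d * A)"
    by (intro mat_trace_averaged_mult rep A) auto
  hence "c * of_nat d = of_nat (card (carrier G)) * mat_trace A"
    using A c mat_trace_smult[of "1\<^sub>m d" d c]
    by (simp add: left_mult_one_mat[OF averaged_carrier] mat_trace_one)
  with d have "c = of_nat (card (carrier G)) * mat_trace A / of_nat d" by (simp add: field_simps)
  with c show ?thesis by simp
qed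

text \<open>
  Products of two traces are turned into entries of averages: with the matrix unit \<open>E\<^sub>a\<^sub>b\<close>, the
  product \<open>X\<^sub>a\<^sub>a Y\<^sub>b\<^sub>b\<close> of diagonal entries is the entry \<open>(a, b)\<close> of \<open>X E\<^sub>a\<^sub>b Y\<close>.
\<close>

lemma sum_mat_trace_mult_trace:
  assumes \<rho>: "is_rep d \<rho>" and \<sigma>: "is_rep e \<sigma>"
    and U: "U \<in> carrier_mat d d" and V: "V \<in> carrier_mat e e"
  shows "(\<Sum>x\<in>carrier G. mat_trace (U * \<rho> x) * mat_trace (\<sigma> (inv x) * V)) =
           (\<Sum>a<d. \<Sum>b<e. (U * averaged d \<rho> e \<sigma> (elem_mat d e a b) * V) $$ (a, b))"
proof -
  note r = is_repD[OF \<rho>] and s = is_repD[OF \<sigma>]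
  have av: "U * averaged d \<rho> e \<sigma> A * V = mat_of_sums d e (\<lambda>x. (U * \<rho> x) * A * (\<sigma> (inv x) * V)) (carrier G)"
    if A: "A \<in> carrier_mat d e" for A
  proof -
    have c: "\<rho> x * A * \<sigma> (inv x) \<in> carrier_mat d e" if "x \<in> carrier G" for x
      using r(1) s(1) A that by (meson inv_closed mult_carrier_mat)
    have "U * averaged d \<rho> e \<sigma> A * V = mat_of_sums d e (\<lambda>x. U * (\<rho> x * A * \<sigma> (inv x)) * V) (carrier G)"
      unfolding averaged_def using U V c
      by (simp add: mult_mat_of_sums_left mult_mat_of_sums_right mult_carrier_mat[OF U])
    also have "\<dots> = mat_of_sums d e (\<lambda>x. (U * \<rho> x) * A * (\<sigma> (inv x) * V)) (carrier G)"
    proof (intro mat_of_sums_cong)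
      fix x assume x: "x \<in> carrier G"
      have cs: "\<rho> x \<in> carrier_mat d d" "\<sigma> (inv x) \<in> carrier_mat e e"
        using r(1) s(1) x by auto
      have "U * (\<rho> x * A * \<sigma> (inv x)) = U * (\<rho> x * A) * \<sigma> (inv x)"
        using cs A U by (intro assoc_mult_mat[symmetric]) auto
      also have "U * (\<rho> x * A) = U * \<rho> x * A"
        using cs A U by (intro assoc_mult_mat[symmetric]) auto
      also have "U * \<rho> x * A * \<sigma> (inv x) * V = U * \<rho> x * A * (\<sigma> (inv x) * V)"
        using cs A U V by (intro assoc_mult_mat) auto
      finally show "U * (\<rho> x * A * \<sigma> (inv x)) * V = (U * \<rho> x) * A * (\<sigma> (inv x) * V)" .
    qed
    finally show ?thesis .
  qed
  have "(\<Sum>a<d. \<Sum>b<e. (U * averaged d \<rho> e \<sigma> (elem_mat d e a b) * V) $$ (a, b)) =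
        (\<Sum>a<d. \<Sum>b<e. \<Sum>x\<in>carrier G. (U * \<rho> x) $$ (a, a) * (\<sigma> (inv x) * V) $$ (b, b))"
  proof (intro sum.cong refl)
    fix a b assume ab: "a \<in> {..<d}" "b \<in> {..<e}"
    show "(U * averaged d \<rho> e \<sigma> (elem_mat d e a b) * V) $$ (a, b) =
      (\<Sum>x\<in>carrier G. (U * \<rho> x) $$ (a, a) * (\<sigma> (inv x) * V) $$ (b, b))"
      unfolding av[OF elem_mat_carrier] using ab U V r(1) s(1)
      by (auto simp: mat_of_sums_def intro!: sum.cong mult_elem_mat_mult[OF mult_carrier_mat[OF U r(1)] mult_carrier_mat[OF s(1) V]]
          simp del: index_mult_mat(1))
  qed
  also have "\<dots> = (\<Sum>x\<in>carrier G. \<Sum>a<d. \<Sum>b<e. (U * \<rho> x) $$ (a, a) * (\<sigma> (inv x) * V) $$ (b, b))"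
    by (simp only: sum.swap[of _ "carrier G"])
  also have "\<dots> = (\<Sum>x\<in>carrier G. mat_trace (U * \<rho> x) * mat_trace (\<sigma> (inv x) * V))"
  proof (intro sum.cong refl)
    fix x assume x: "x \<in> carrier G"
    have cs: "U * \<rho> x \<in> carrier_mat d d" "\<sigma> (inv x) * V \<in> carrier_mat e e"
      using mult_carrier_mat[OF U r(1)[OF x]] mult_carrier_mat[OF s(1)[of "inv x"] V] x by simp_all
    show "(\<Sum>a<d. \<Sum>b<e. (U * \<rho> x) $$ (a, a) * (\<sigma> (inv x) * V) $$ (b, b)) =
       mat_trace (U * \<rho> x) * mat_trace (\<sigma> (inv x) * V)"
      using cs by (simp add: mat_trace_carrier sum_product del: index_mult_mat(1))
  qed
  finally show ?thesis by simp
qed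

lemma simple_sum_trace_mult_trace:
  assumes \<rho>: "simple_rep d \<rho>" and u: "u \<in> carrier G" and v: "v \<in> carrier G"
  shows "(\<Sum>x\<in>carrier G. mat_trace (\<rho> (u \<otimes> x)) * mat_trace (\<rho> (inv x \<otimes> v))) =
           of_nat (card (carrier G)) / of_nat d * mat_trace (\<rho> (u \<otimes> v))"
proof -
  have rep: "is_rep d \<rho>" using \<rho> by (simp add: simple_rep_def)
  note r = is_repD[OF rep]
  have "(\<Sum>x\<in>carrier G. mat_trace (\<rho> (u \<otimes> x)) * mat_trace (\<rho> (inv x \<otimes> v))) =
        (\<Sum>x\<in>carrier G. mat_trace (\<rho> u * \<rho> x) * mat_trace (\<rho> (inv x) * \<rho> v))"
    using u v by (simp add: r(2))
  also have "\<dots> = (\<Sum>a<d. \<Sum>b<d. (\<rho> u * averaged d \<rho> d \<rho> (elem_mat d d a b) * \<rho> v) $$ (a, b))"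
    using r(1) u v by (intro sum_mat_trace_mult_trace rep) auto
  also have "\<dots> = (\<Sum>a<d. \<Sum>b<d. if a = b then of_nat (card (carrier G)) / of_nat d * (\<rho> u * \<rho> v) $$ (a, a) else 0)"
  proof (intro sum.cong refl)
    fix a b assume ab: "a \<in> {..<d}" "b \<in> {..<d}"
    have tr: "mat_trace (elem_mat d d a b) = (if a = b then 1 else 0)"
      using ab by (subst mat_trace_carrier[of _ d]) (auto simp: elem_mat_def sum.delta if_distrib cong: if_cong)
    have c: "\<rho> u \<in> carrier_mat d d" "\<rho> v \<in> carrier_mat d d" using r(1) u v by auto
    have "\<rho> u * (k \<cdot>\<^sub>m 1\<^sub>m d) * \<rho> v = k \<cdot>\<^sub>m (\<rho> u * \<rho> v)" for k
      using c by (simp add: mult_scalar_mat[of _ d d] mult_smult_assoc_mat[of _ d d])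
    thus "(\<rho> u * averaged d \<rho> d \<rho> (elem_mat d d a b) * \<rho> v) $$ (a, b) =
        (if a = b then of_nat (card (carrier G)) / of_nat d * (\<rho> u * \<rho> v) $$ (a, a) else 0)"
      using ab c by (auto simp: averaged_simple[OF \<rho>] tr simp del: index_mult_mat(1))
  qed
  also have "\<dots> = of_nat (card (carrier G)) / of_nat d * mat_trace (\<rho> (u \<otimes> v))"
    using r(1)[of "u \<otimes> v"] u v
    by (simp add: mat_trace_carrier[of _ d] r(2) sum_distrib_left del: index_mult_mat(1))
  finally show ?thesis .
qed

lemma simple_sum_trace_conj:
  assumes \<rho>: "simple_rep d \<rho>" and u: "u \<in> carrier G" and v: "v \<in> carrier G"
  shows "(\<Sum>x\<in>carrier G. mat_trace (\<rho> (u \<otimes> (x \<otimes> (v \<otimes> inv x))))) =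
           of_nat (card (carrier G)) / of_nat d * (mat_trace (\<rho> u) * mat_trace (\<rho> v))"
proof -
  have rep: "is_rep d \<rho>" using \<rho> by (simp add: simple_rep_def)
  note r = is_repD[OF rep]
  have c: "\<rho> u \<in> carrier_mat d d" "\<rho> v \<in> carrier_mat d d" using r(1) u v by auto
  have cx: "\<rho> x * \<rho> v * \<rho> (inv x) \<in> carrier_mat d d" if "x \<in> carrier G" for x
    using r(1) c that by (meson inv_closed mult_carrier_mat)
  have "(\<Sum>x\<in>carrier G. mat_trace (\<rho> (u \<otimes> (x \<otimes> (v \<otimes> inv x))))) =
        (\<Sum>x\<in>carrier G. mat_trace (\<rho> u * (\<rho> x * \<rho> v * \<rho> (inv x))))"
    using u v by (intro sum.cong refl) (simp add: r(2) assoc_mult_mat[OF r(1) r(1) r(1)])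
  also have "\<dots> = mat_trace (\<rho> u * averaged d \<rho> d \<rho> (\<rho> v))"
    unfolding averaged_def using c cx
    by (simp add: mult_mat_of_sums_left mat_trace_mat_of_sums mult_carrier_mat[OF c(1)])
  also have "\<dots> = of_nat (card (carrier G)) / of_nat d * (mat_trace (\<rho> u) * mat_trace (\<rho> v))"
    using c by (simp add: averaged_simple[OF \<rho>] mult_scalar_mat[of _ d d] mat_trace_smult[of _ d])
  finally show ?thesis .
qed

text \<open>
  If some average \<open>T\<close> is nonzero, then a suitable average \<open>S\<close> in the other direction makes \<open>T S\<close> and
  \<open>S T\<close> nonzero scalars. They agree because \<open>(T S) T = T (S T)\<close>, and so the two representations have the
  same character.
\<close>

lemma simple_orthogonal:
  assumes \<rho>: "simple_rep d \<rho>" and \<sigma>: "simple_rep e \<sigma>"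
    and neq: "\<exists>g\<in>carrier G. mat_trace (\<rho> g) \<noteq> mat_trace (\<sigma> g)"
  shows "(\<Sum>x\<in>carrier G. mat_trace (\<rho> x) * mat_trace (\<sigma> (inv x))) = 0"
proof -
  have rep: "is_rep d \<rho>" "is_rep e \<sigma>" using \<rho> \<sigma> by (auto simp: simple_rep_def)
  have d: "d > 0" "e > 0" using \<rho> \<sigma> by (auto simp: simple_rep_def)
  note r = is_repD[OF rep(1)] and s = is_repD[OF rep(2)]
  have zero: "averaged d \<rho> e \<sigma> A = 0\<^sub>m d e" if A: "A \<in> carrier_mat d e" for A
  proof (rule ccontr)
    define T where "T = averaged d \<rho> e \<sigma> A"
    have T: "T \<in> carrier_mat d e" by (simp add: T_def)
    have comm: "\<rho> x * T = T * \<sigma> x" if "x \<in> carrier G" for x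
      unfolding T_def using averaged_intertwines[OF rep A that] .
    assume "averaged d \<rho> e \<sigma> A \<noteq> 0\<^sub>m d e"
    then obtain a b where ab: "a < d" "b < e" "T $$ (a, b) \<noteq> 0"
      using T eq_matI[of "0\<^sub>m d e" T] unfolding T_def[symmetric] by auto
    \<comment> \<open>The matrix unit is chosen so that \<open>tr (T S) = |G| T\<^sub>a\<^sub>b \<noteq> 0\<close>.\<close>
    define S where "S = averaged e \<sigma> d \<rho> (elem_mat e d b a)"
    have S: "S \<in> carrier_mat e d" by (simp add: S_def)
    have commS: "\<sigma> x * S = S * \<rho> x" if "x \<in> carrier G" for x
      unfolding S_def using averaged_intertwines[OF rep(2,1) _ that] by simp
    have cx: "\<rho> x \<in> carrier_mat d d" "\<sigma> x \<in> carrier_mat e e" if "x \<in> carrier G" for x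
      using r(1) s(1) that by auto
    have "\<rho> x * (T * S) = (T * S) * \<rho> x" if x: "x \<in> carrier G" for x
    proof -
      have "\<rho> x * (T * S) = T * \<sigma> x * S"
        using cx[OF x] S T comm[OF x] by (metis assoc_mult_mat)
      also have "\<dots> = T * (\<sigma> x * S)" using cx[OF x] S T by (intro assoc_mult_mat) auto
      also have "\<dots> = (T * S) * \<rho> x" using cx[OF x] S T commS[OF x] by (metis assoc_mult_mat)
      finally show ?thesis .
    qed
    from simple_repD[OF \<rho> mult_carrier_mat[OF T S] this]
    obtain k where k: "T * S = k \<cdot>\<^sub>m 1\<^sub>m d" ..
    have "\<sigma> x * (S * T) = (S * T) * \<sigma> x" if x: "x \<in> carrier G" for x
    proof -
      have "\<sigma> x * (S * T) = S * \<rho> x * T"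
        using cx[OF x] S T commS[OF x] by (metis assoc_mult_mat)
      also have "\<dots> = S * (\<rho> x * T)" using cx[OF x] S T by (intro assoc_mult_mat) auto
      also have "\<dots> = (S * T) * \<sigma> x" using cx[OF x] S T comm[OF x] by (metis assoc_mult_mat)
      finally show ?thesis .
    qed
    from simple_repD[OF \<sigma> mult_carrier_mat[OF S T] this]
    obtain m where m: "S * T = m \<cdot>\<^sub>m 1\<^sub>m e" ..
    have "mat_trace (T * S) = of_nat (card (carrier G)) * mat_trace (T * elem_mat e d b a)"
      unfolding S_def using comm T by (intro mat_trace_averaged_mult rep) auto
    also have "mat_trace (T * elem_mat e d b a) = T $$ (a, b)"
      using T ab by (intro mat_trace_mult_elem_mat)
    finally have "mat_trace (T * S) \<noteq> 0"
      using ab(3) finite_carrier by auto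
    hence k0: "k \<noteq> 0"
      using mat_trace_smult[of "1\<^sub>m d" d k] by (auto simp: k mat_trace_one)
    have "(k \<cdot>\<^sub>m 1\<^sub>m d) * T = T * (m \<cdot>\<^sub>m 1\<^sub>m e)"
      using S T unfolding k[symmetric] m[symmetric] by (intro assoc_mult_mat) auto
    hence "k \<cdot>\<^sub>m T = m \<cdot>\<^sub>m T"
      using T by (simp add: mult_scalar_mat[of _ d e])
    hence "(k \<cdot>\<^sub>m T) $$ (a, b) = (m \<cdot>\<^sub>m T) $$ (a, b)" by simp
    hence km: "k = m" using ab T by simp
    have "mat_trace (\<rho> x) = mat_trace (\<sigma> x)" if x: "x \<in> carrier G" for x
    proof -
      have "k * mat_trace (\<rho> x) = mat_trace (\<rho> x * (T * S))"
        unfolding k using cx[OF x] by (simp add: mult_scalar_mat[of _ d d] mat_trace_smult[of _ d])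
      also have "\<rho> x * (T * S) = \<rho> x * T * S"
        using cx[OF x] S T by (intro assoc_mult_mat[symmetric]) auto
      also have "\<rho> x * T = T * \<sigma> x" using comm[OF x] .
      also have "T * \<sigma> x * S = T * (\<sigma> x * S)"
        using cx[OF x] S T by (intro assoc_mult_mat) auto
      also have "mat_trace \<dots> = mat_trace (\<sigma> x * S * T)"
        using cx[OF x] S T by (intro mat_trace_mult_comm[of _ d e]) auto
      also have "\<sigma> x * S * T = \<sigma> x * (S * T)"
        using cx[OF x] S T by (intro assoc_mult_mat) auto
      also have "mat_trace \<dots> = k * mat_trace (\<sigma> x)"
        unfolding m km using cx[OF x] by (simp add: mult_scalar_mat[of _ e e] mat_trace_smult[of _ e])
      finally show ?thesis using k0 by simp
    qed
    with neq show False by blast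
  qed
  have "(\<Sum>x\<in>carrier G. mat_trace (\<rho> x) * mat_trace (\<sigma> (inv x))) =
        (\<Sum>x\<in>carrier G. mat_trace (1\<^sub>m d * \<rho> x) * mat_trace (\<sigma> (inv x) * 1\<^sub>m e))"
    by (intro sum.cong refl) (simp add: left_mult_one_mat[OF r(1)] right_mult_one_mat[OF s(1)])
  also have "\<dots> = (\<Sum>a<d. \<Sum>b<e. (1\<^sub>m d * averaged d \<rho> e \<sigma> (elem_mat d e a b) * 1\<^sub>m e) $$ (a, b))"
    by (intro sum_mat_trace_mult_trace rep) auto
  also have "\<dots> = 0"
    by (intro sum.neutral ballI) (simp add: zero del: index_mult_mat(1))
  finally show ?thesis .
qed

section \<open>Decomposition into simple characters\<close>

lemma is_rep_conjugate:
  assumes \<rho>: "is_rep d \<rho>" and PQ: "P \<in> carrier_mat d d" "Q \<in> carrier_mat d d" "P * Q = 1\<^sub>m d" "Q * P = 1\<^sub>m d"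
  shows "is_rep d (\<lambda>g. P * \<rho> g * Q)"
    and "g \<in> carrier G \<Longrightarrow> mat_trace (P * \<rho> g * Q) = mat_trace (\<rho> g)"
proof -
  note r = is_repD[OF \<rho>]
  show "is_rep d (\<lambda>g. P * \<rho> g * Q)"
    unfolding is_rep_def
  proof (intro conjI ballI)
    fix g h assume gh: "g \<in> carrier G" "h \<in> carrier G"
    have c: "\<rho> g \<in> carrier_mat d d" "\<rho> h \<in> carrier_mat d d" using r(1) gh by auto
    have "P * \<rho> g * Q * (P * \<rho> h * Q) = P * \<rho> g * (Q * (P * \<rho> h * Q))"
      using PQ c by (intro assoc_mult_mat) auto
    also have "Q * (P * \<rho> h * Q) = Q * (P * \<rho> h) * Q"
      using PQ c by (intro assoc_mult_mat[symmetric]) auto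
    also have "Q * (P * \<rho> h) = Q * P * \<rho> h"
      using PQ c by (intro assoc_mult_mat[symmetric]) auto
    also have "Q * P * \<rho> h = \<rho> h" using PQ c by simp
    also have "P * \<rho> g * (\<rho> h * Q) = P * \<rho> g * \<rho> h * Q"
      using PQ c by (intro assoc_mult_mat[symmetric]) auto
    also have "P * \<rho> g * \<rho> h = P * (\<rho> g * \<rho> h)"
      using PQ c by (intro assoc_mult_mat) auto
    finally show "P * \<rho> (g \<otimes> h) * Q = P * \<rho> g * Q * (P * \<rho> h * Q)"
      using r(2)[OF gh] by simp
  next
    fix g assume "g \<in> carrier G"
    thus "P * \<rho> g * Q \<in> carrier_mat d d" using r(1)[of g] PQ by simp
  qed (use PQ r(3) in simp)
  show "mat_trace (P * \<rho> g * Q) = mat_trace (\<rho> g)" if "g \<in> carrier G"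
  proof -
    have c: "\<rho> g \<in> carrier_mat d d" using r(1) that .
    have "mat_trace (P * \<rho> g * Q) = mat_trace (Q * (P * \<rho> g))"
      using c PQ by (intro mat_trace_mult_comm[of _ d d]) auto
    also have "Q * (P * \<rho> g) = Q * P * \<rho> g" using c PQ by (intro assoc_mult_mat[symmetric]) auto
    finally show ?thesis using PQ c by simp
  qed
qed

text \<open>
  The two diagonal blocks of a block triangular representation are representations. The
  off-diagonal block is irrelevant for the trace, so complete reducibility is not needed.
\<close>

lemma is_rep_block_triangular:
  assumes \<rho>: "is_rep (r + s) \<rho>"
    and zero: "\<And>g i j. g \<in> carrier G \<Longrightarrow> i < s \<Longrightarrow> j < r \<Longrightarrow> \<rho> g $$ (r + i, j) = 0"
  shows "\<exists>\<sigma> \<tau>. is_rep r \<sigma> \<and> is_rep s \<tau> \<and>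
           (\<forall>g\<in>carrier G. mat_trace (\<rho> g) = mat_trace (\<sigma> g) + mat_trace (\<tau> g))"
proof (intro exI conjI ballI)
  note p = is_repD[OF \<rho>]
  define \<sigma> where "\<sigma> g = mat r r (\<lambda>(i, j). \<rho> g $$ (i, j))" for g
  define \<tau> where "\<tau> g = mat s s (\<lambda>(i, j). \<rho> g $$ (r + i, r + j))" for g
  have prod: "\<rho> (g \<otimes> h) $$ (i, j) =
      (\<Sum>k<r. \<rho> g $$ (i, k) * \<rho> h $$ (k, j)) + (\<Sum>k<s. \<rho> g $$ (i, r + k) * \<rho> h $$ (r + k, j))"
    if gh: "g \<in> carrier G" "h \<in> carrier G" and ij: "i < r + s" "j < r + s" for g h i j
  proof -
    have "\<rho> (g \<otimes> h) $$ (i, j) = (\<Sum>k<r+s. \<rho> g $$ (i, k) * \<rho> h $$ (k, j))"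
      unfolding p(2)[OF gh] by (rule index_mult_mat_sum[OF p(1)[OF gh(1)] p(1)[OF gh(2)] ij])
    thus ?thesis by (simp only: sum_lessThan_add)
  qed
  show "is_rep r \<sigma>"
    unfolding is_rep_def
  proof (intro conjI ballI)
    fix g h assume gh: "g \<in> carrier G" "h \<in> carrier G"
    show "\<sigma> (g \<otimes> h) = \<sigma> g * \<sigma> h"
    proof (rule eq_matI)
      fix i j assume "i < dim_row (\<sigma> g * \<sigma> h)" "j < dim_col (\<sigma> g * \<sigma> h)"
      hence ij: "i < r" "j < r" by (auto simp: \<sigma>_def)
      have "(\<sigma> g * \<sigma> h) $$ (i, j) = (\<Sum>k<r. \<rho> g $$ (i, k) * \<rho> h $$ (k, j))"
        using ij by (subst index_mult_mat_sum[of _ r r _ r]) (auto simp: \<sigma>_def)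
      thus "\<sigma> (g \<otimes> h) $$ (i, j) = (\<sigma> g * \<sigma> h) $$ (i, j)"
        using ij gh prod[OF gh, of i j] zero[of h _ j] by (simp add: \<sigma>_def)
    qed (auto simp: \<sigma>_def)
  next
    show "\<sigma> \<one> = 1\<^sub>m r" by (intro eq_matI) (auto simp: \<sigma>_def p(3))
  qed (auto simp: \<sigma>_def)
  show "is_rep s \<tau>"
    unfolding is_rep_def
  proof (intro conjI ballI)
    fix g h assume gh: "g \<in> carrier G" "h \<in> carrier G"
    show "\<tau> (g \<otimes> h) = \<tau> g * \<tau> h"
    proof (rule eq_matI)
      fix i j assume "i < dim_row (\<tau> g * \<tau> h)" "j < dim_col (\<tau> g * \<tau> h)"
      hence ij: "i < s" "j < s" by (auto simp: \<tau>_def)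
      have "(\<tau> g * \<tau> h) $$ (i, j) = (\<Sum>k<s. \<rho> g $$ (r + i, r + k) * \<rho> h $$ (r + k, r + j))"
        using ij by (subst index_mult_mat_sum[of _ s s _ s]) (auto simp: \<tau>_def)
      thus "\<tau> (g \<otimes> h) $$ (i, j) = (\<tau> g * \<tau> h) $$ (i, j)"
        using ij gh prod[OF gh, of "r + i" "r + j"] zero[of g i] by (simp add: \<tau>_def)
    qed (auto simp: \<tau>_def)
  next
    show "\<tau> \<one> = 1\<^sub>m s" by (intro eq_matI) (auto simp: \<tau>_def p(3))
  qed (auto simp: \<tau>_def)
  fix g assume "g \<in> carrier G"
  thus "mat_trace (\<rho> g) = mat_trace (\<sigma> g) + mat_trace (\<tau> g)"
    using p(1)[of g] by (simp add: mat_trace_carrier sum_lessThan_add) (simp add: mat_trace_def \<sigma>_def \<tau>_def)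
qed

text \<open>
  A non-scalar matrix \<open>T\<close> commuting with \<open>\<rho>\<close> has an eigenvalue \<open>c\<close>, and \<open>N = T - c\<close> is singular,
  nonzero and commutes with \<open>\<rho>\<close>. In a basis that row-reduces \<open>N\<close>, the representation \<open>\<rho>\<close> is block triangular.
\<close>

lemma not_simple_rep_split:
  assumes \<rho>: "is_rep d \<rho>" and d: "d > 0" and ns: "\<not> simple_rep d \<rho>"
  obtains r s \<sigma> \<tau> where "r < d" "s < d" "is_rep r \<sigma>" "is_rep s \<tau>"
    "\<And>g. g \<in> carrier G \<Longrightarrow> mat_trace (\<rho> g) = mat_trace (\<sigma> g) + mat_trace (\<tau> g)"
proof -
  note p = is_repD[OF \<rho>]
  obtain T where T: "T \<in> carrier_mat d d" and comm: "\<And>x. x \<in> carrier G \<Longrightarrow> \<rho> x * T = T * \<rho> x"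
    and nonscalar: "\<And>c. T \<noteq> c \<cdot>\<^sub>m 1\<^sub>m d"
    using \<rho> d ns unfolding simple_rep_def by blast
  obtain c where "eigenvalue T c"
    using spectrum_non_empty[OF T d] unfolding spectrum_def by blast
  then obtain v where "eigenvector T v c" unfolding eigenvalue_def by blast
  define N where "N = char_matrix T c"
  have N_eq: "N = T + (- c) \<cdot>\<^sub>m 1\<^sub>m d" using T by (simp add: N_def char_matrix_def)
  have N: "N \<in> carrier_mat d d" unfolding N_eq using T by simp
  have v: "v \<in> carrier_vec d" "v \<noteq> 0\<^sub>v d" and Nv: "N *\<^sub>v v = 0\<^sub>v d"
    using \<open>eigenvector T v c\<close> unfolding eigenvector_char_matrix[OF T] N_def by auto
  have nz: "N \<noteq> 0\<^sub>m d d"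
  proof
    assume N0: "N = 0\<^sub>m d d"
    have "T = c \<cdot>\<^sub>m 1\<^sub>m d"
    proof (rule eq_matI)
      fix i j assume ij: "i < dim_row (c \<cdot>\<^sub>m 1\<^sub>m d)" "j < dim_col (c \<cdot>\<^sub>m 1\<^sub>m d)"
      hence "N $$ (i, j) = T $$ (i, j) - (c \<cdot>\<^sub>m 1\<^sub>m d) $$ (i, j)" using T unfolding N_eq by simp
      thus "T $$ (i, j) = (c \<cdot>\<^sub>m 1\<^sub>m d) $$ (i, j)" using ij N0 by simp
    qed (use T in auto)
    with nonscalar show False by blast
  qed
  have commN: "\<rho> x * N = N * \<rho> x" if "x \<in> carrier G" for x
  proof -
    have c: "\<rho> x \<in> carrier_mat d d" using p(1) that .
    have "\<rho> x * N = \<rho> x * T + \<rho> x * ((- c) \<cdot>\<^sub>m 1\<^sub>m d)"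
      unfolding N_eq using c T by (intro mult_add_distrib_mat[of _ d d]) auto
    also have "\<dots> = T * \<rho> x + ((- c) \<cdot>\<^sub>m 1\<^sub>m d) * \<rho> x"
      using comm[OF that] by (simp add: mult_scalar_mat[OF c])
    also have "\<dots> = N * \<rho> x"
      unfolding N_eq using c T by (intro add_mult_distrib_mat[of _ d d, symmetric]) auto
    finally show ?thesis .
  qed
  obtain P Q r f where PQ: "P \<in> carrier_mat d d" "Q \<in> carrier_mat d d" "P * Q = 1\<^sub>m d" "Q * P = 1\<^sub>m d"
    and r: "0 < r" "r < d"
    and zero: "\<And>i j. r \<le> i \<Longrightarrow> i < d \<Longrightarrow> j < d \<Longrightarrow> (P * N) $$ (i, j) = 0"
    and unit: "\<And>i j. i < d \<Longrightarrow> j < r \<Longrightarrow> f j < d \<and> (P * N) $$ (i, f j) = (if i = j then 1 else 0)"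
    using singular_row_reduction[OF N nz v Nv] by blast
  define \<rho>' where "\<rho>' g = P * \<rho> g * Q" for g
  have \<rho>': "is_rep d \<rho>'" unfolding \<rho>'_def by (rule is_rep_conjugate[OF \<rho> PQ])
  have PN: "P * N \<in> carrier_mat d d" using PQ N by simp
  have below: "\<rho>' g $$ (i, j) = 0" if g: "g \<in> carrier G" and ij: "r \<le> i" "i < d" "j < r" for g i j
  proof -
    have c: "\<rho> g \<in> carrier_mat d d" using p(1) g .
    \<comment> \<open>Column \<open>f j\<close> of \<open>P N\<close> picks out column \<open>j\<close> of \<open>\<rho>' g\<close> on the left of the following identity;
      on the right, row \<open>i \<ge> r\<close> of \<open>P N\<close> vanishes.\<close>
    have "\<rho>' g * (P * N) = P * \<rho> g * (Q * (P * N))"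
      unfolding \<rho>'_def using c PQ N by (intro assoc_mult_mat) auto
    also have "Q * (P * N) = Q * P * N" using PQ N by (intro assoc_mult_mat[symmetric]) auto
    also have "\<dots> = N" using PQ N by simp
    also have "P * \<rho> g * N = P * (\<rho> g * N)" using PQ N c by (intro assoc_mult_mat) auto
    also have "\<rho> g * N = N * \<rho> g" by (rule commN[OF g])
    also have "P * (N * \<rho> g) = P * N * \<rho> g" using PQ N c by (intro assoc_mult_mat[symmetric]) auto
    finally have eq: "\<rho>' g * (P * N) = P * N * \<rho> g" .
    have fj: "f j < d" using unit[of i j] ij by simp
    have "(\<rho>' g * (P * N)) $$ (i, f j) = (\<Sum>k<d. \<rho>' g $$ (i, k) * (P * N) $$ (k, f j))"
      using fj ij by (intro index_mult_mat_sum[OF is_repD(1)[OF \<rho>' g] PN]) auto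
    also have "\<dots> = (\<Sum>k<d. if k = j then \<rho>' g $$ (i, k) else 0)"
      using ij unit by (intro sum.cong refl) auto
    also have "\<dots> = \<rho>' g $$ (i, j)" using ij r by simp
    finally have "\<rho>' g $$ (i, j) = (P * N * \<rho> g) $$ (i, f j)" by (simp add: eq)
    also have "\<dots> = (\<Sum>k<d. (P * N) $$ (i, k) * \<rho> g $$ (k, f j))"
      using fj ij by (intro index_mult_mat_sum[OF PN c]) auto
    also have "\<dots> = 0" using ij zero by (intro sum.neutral) auto
    finally show ?thesis .
  qed
  have rep': "is_rep (r + (d - r)) \<rho>'" using \<rho>' r by simp
  have zero': "\<rho>' g $$ (r + i, j) = 0" if "g \<in> carrier G" "i < d - r" "j < r" for g i j
    using that by (intro below) auto
  obtain \<sigma> \<tau> where "is_rep r \<sigma>" "is_rep (d - r) \<tau>"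
    "\<And>g. g \<in> carrier G \<Longrightarrow> mat_trace (\<rho>' g) = mat_trace (\<sigma> g) + mat_trace (\<tau> g)"
    using is_rep_block_triangular[OF rep' zero'] by blast
  moreover have "mat_trace (\<rho>' g) = mat_trace (\<rho> g)" if "g \<in> carrier G" for g
    unfolding \<rho>'_def by (rule is_rep_conjugate(2)[OF \<rho> PQ that])
  ultimately show thesis using r by (intro that[of r "d - r" \<sigma> \<tau>]) auto
qed

text \<open>
  Characters of simple representations. They are normalised to be \<open>undefined\<close> outside the carrier, so
  that two of them are equal as functions if and only if they agree on the group.
\<close>

definition simple_char :: "('a \<Rightarrow> complex) \<Rightarrow> bool" where
  "simple_char \<chi> \<longleftrightarrow> (\<exists>d \<rho>. simple_rep d \<rho> \<and> \<chi> = (\<lambda>g\<in>carrier G. mat_trace (\<rho> g)))"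

lemma rep_trace_eq_sum_simple_chars:
  "is_rep d \<rho> \<Longrightarrow> \<exists>cs. set cs \<subseteq> Collect simple_char \<and> (\<forall>g\<in>carrier G. mat_trace (\<rho> g) = (\<Sum>c\<leftarrow>cs. c g))"
proof (induction d arbitrary: \<rho> rule: less_induct)
  case (less d)
  consider "d = 0" | "simple_rep d \<rho>" | "d > 0" "\<not> simple_rep d \<rho>" by blast
  thus ?case
  proof cases
    case 1
    thus ?thesis using is_repD(1)[OF less.prems] by (intro exI[of _ "[]"]) (simp add: mat_trace_carrier[of _ 0])
  next
    case 2
    hence "simple_char (\<lambda>g\<in>carrier G. mat_trace (\<rho> g))" unfolding simple_char_def by blast
    thus ?thesis by (intro exI[of _ "[\<lambda>g\<in>carrier G. mat_trace (\<rho> g)]"]) simp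
  next
    case 3
    obtain r s \<sigma> \<tau> where *: "r < d" "s < d" "is_rep r \<sigma>" "is_rep s \<tau>"
      "\<And>g. g \<in> carrier G \<Longrightarrow> mat_trace (\<rho> g) = mat_trace (\<sigma> g) + mat_trace (\<tau> g)"
      using not_simple_rep_split[OF less.prems 3] by blast
    obtain cs cs' where "set cs \<subseteq> Collect simple_char" "\<forall>g\<in>carrier G. mat_trace (\<sigma> g) = (\<Sum>c\<leftarrow>cs. c g)"
      "set cs' \<subseteq> Collect simple_char" "\<forall>g\<in>carrier G. mat_trace (\<tau> g) = (\<Sum>c\<leftarrow>cs'. c g)"
      using less.IH[OF *(1,3)] less.IH[OF *(2,4)] by blast
    thus ?thesis using *(5) by (intro exI[of _ "cs @ cs'"]) simp
  qed
qed

section \<open>Identities for simple characters\<close>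

lemma simple_char_is_character: "simple_char \<chi> \<Longrightarrow> is_character G \<chi>"
  unfolding simple_char_def simple_rep_def is_character_iff by (metis restrict_apply')

lemma simple_char_one:
  assumes "simple_char \<chi>"
  obtains d where "d > 0" "\<chi> \<one> = of_nat d"
proof -
  obtain d \<rho> where "simple_rep d \<rho>" "\<chi> = (\<lambda>g\<in>carrier G. mat_trace (\<rho> g))"
    using assms unfolding simple_char_def by blast
  thus thesis using that[of d] is_repD(3)[of d \<rho>] by (simp add: simple_rep_def mat_trace_one)
qed

lemma simple_char_comm:
  assumes \<chi>: "simple_char \<chi>" and x: "x \<in> carrier G" and y: "y \<in> carrier G"
  shows "\<chi> (x \<otimes> y) = \<chi> (y \<otimes> x)"
proof -
  obtain d \<rho> where "simple_rep d \<rho>" "\<chi> = (\<lambda>g\<in>carrier G. mat_trace (\<rho> g))"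
    using assms unfolding simple_char_def by blast
  thus ?thesis using x y is_repD(1,2)[of d \<rho>] mat_trace_mult_comm[of "\<rho> x" d d "\<rho> y"]
    by (simp add: simple_rep_def)
qed

lemma simple_char_sum_mult:
  assumes \<chi>: "simple_char \<chi>" and u: "u \<in> carrier G" and v: "v \<in> carrier G"
  shows "(\<Sum>x\<in>carrier G. \<chi> (u \<otimes> x) * \<chi> (inv x \<otimes> v)) = of_nat (card (carrier G)) / \<chi> \<one> * \<chi> (u \<otimes> v)"
proof -
  obtain d \<rho> where \<rho>: "simple_rep d \<rho>" "\<chi> = (\<lambda>g\<in>carrier G. mat_trace (\<rho> g))"
    using assms unfolding simple_char_def by blast
  thus ?thesis using u v simple_sum_trace_mult_trace[OF \<rho>(1) u v] is_repD(3)[of d \<rho>]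
    by (simp add: simple_rep_def mat_trace_one)
qed

lemma simple_char_sum_conj:
  assumes \<chi>: "simple_char \<chi>" and u: "u \<in> carrier G" and v: "v \<in> carrier G"
  shows "(\<Sum>x\<in>carrier G. \<chi> (u \<otimes> (x \<otimes> (v \<otimes> inv x)))) = of_nat (card (carrier G)) / \<chi> \<one> * (\<chi> u * \<chi> v)"
proof -
  obtain d \<rho> where \<rho>: "simple_rep d \<rho>" "\<chi> = (\<lambda>g\<in>carrier G. mat_trace (\<rho> g))"
    using assms unfolding simple_char_def by blast
  thus ?thesis using u v simple_sum_trace_conj[OF \<rho>(1) u v] is_repD(3)[of d \<rho>]
    by (simp add: simple_rep_def mat_trace_one)
qed

lemma simple_char_orthonormal:
  assumes \<chi>: "simple_char \<chi>" and \<psi>: "simple_char \<psi>"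
  shows "(\<Sum>x\<in>carrier G. \<chi> x * \<psi> (inv x)) = (if \<chi> = \<psi> then of_nat (card (carrier G)) else 0)"
proof (cases "\<chi> = \<psi>")
  case True
  obtain d where "d > 0" "\<chi> \<one> = of_nat d" using simple_char_one[OF \<chi>] .
  thus ?thesis using simple_char_sum_mult[OF \<chi>, of \<one> \<one>] True by simp
next
  case False
  obtain d \<rho> where \<rho>: "simple_rep d \<rho>" "\<chi> = (\<lambda>g\<in>carrier G. mat_trace (\<rho> g))"
    using \<chi> unfolding simple_char_def by blast
  obtain e \<sigma> where \<sigma>: "simple_rep e \<sigma>" "\<psi> = (\<lambda>g\<in>carrier G. mat_trace (\<sigma> g))"
    using \<psi> unfolding simple_char_def by blast
  have "\<exists>g\<in>carrier G. mat_trace (\<rho> g) \<noteq> mat_trace (\<sigma> g)"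
  proof (rule ccontr)
    assume "\<not> ?thesis"
    hence "\<chi> = \<psi>" unfolding \<rho>(2) \<sigma>(2) by (intro restrict_ext) simp
    with False show False ..
  qed
  from simple_orthogonal[OF \<rho>(1) \<sigma>(1) this] False show ?thesis by (simp add: \<rho>(2) \<sigma>(2))
qed

section \<open>The regular character\<close>

lemma regular_rep:
  obtains \<rho> where "is_rep (card (carrier G)) \<rho>"
    "\<And>g. g \<in> carrier G \<Longrightarrow> mat_trace (\<rho> g) = (if g = \<one> then of_nat (card (carrier G)) else 0)"
proof -
  define n where "n = card (carrier G)"
  obtain e where "bij_betw e {0..<n} (carrier G)"
    using ex_bij_betw_nat_finite[OF finite_carrier] unfolding n_def by blast
  hence e: "bij_betw e {..<n} (carrier G)" by (simp add: atLeast0LessThan)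
  have eC: "e i \<in> carrier G" if "i < n" for i using e that by (auto simp: bij_betw_def)
  have e_inj: "e i = e j \<longleftrightarrow> i = j" if "i < n" "j < n" for i j
    using e that by (auto simp: bij_betw_def inj_on_def)
  have e_surj: "\<exists>k<n. e k = x" if "x \<in> carrier G" for x
    using e that by (force simp: bij_betw_def)
  define \<rho> where "\<rho> g = mat n n (\<lambda>(i, j). if g \<otimes> e j = e i then 1 else 0 :: complex)" for g
  have "is_rep n \<rho>"
    unfolding is_rep_def
  proof (intro conjI ballI)
    fix g h assume gh: "g \<in> carrier G" "h \<in> carrier G"
    show "\<rho> (g \<otimes> h) = \<rho> g * \<rho> h"
    proof (rule eq_matI)
      fix i j assume "i < dim_row (\<rho> g * \<rho> h)" "j < dim_col (\<rho> g * \<rho> h)"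
      hence ij: "i < n" "j < n" by (auto simp: \<rho>_def)
      obtain k where k: "k < n" "e k = h \<otimes> e j" using e_surj[of "h \<otimes> e j"] gh eC[OF ij(2)] by auto
      have "(\<rho> g * \<rho> h) $$ (i, j) = (\<Sum>l<n. \<rho> g $$ (i, l) * \<rho> h $$ (l, j))"
        using ij by (intro index_mult_mat_sum) (auto simp: \<rho>_def)
      also have "\<dots> = (\<Sum>l<n. if l = k then \<rho> g $$ (i, l) else 0)"
        using ij k by (intro sum.cong refl) (auto simp: \<rho>_def k(2)[symmetric] e_inj)
      also have "\<dots> = \<rho> g $$ (i, k)" using k by simp
      also have "\<dots> = \<rho> (g \<otimes> h) $$ (i, j)"
        using ij k gh eC by (simp add: \<rho>_def m_assoc)
      finally show "\<rho> (g \<otimes> h) $$ (i, j) = (\<rho> g * \<rho> h) $$ (i, j)" by simp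
    qed (auto simp: \<rho>_def)
  next
    show "\<rho> \<one> = 1\<^sub>m n" using eC by (intro eq_matI) (auto simp: \<rho>_def e_inj)
  qed (auto simp: \<rho>_def)
  moreover have "mat_trace (\<rho> g) = (if g = \<one> then of_nat n else 0)" if g: "g \<in> carrier G" for g
  proof -
    have "mat_trace (\<rho> g) = (\<Sum>i<n. if g \<otimes> e i = e i then 1 else 0)"
      by (simp add: mat_trace_def \<rho>_def)
    also have "\<dots> = (\<Sum>i<n. if g = \<one> then 1 else 0)"
      using g eC by (intro sum.cong refl) (simp add: r_cancel_one)
    finally show ?thesis by simp
  qed
  ultimately show thesis using that unfolding n_def by blast
qed

text \<open>
  The regular character is \<open>|G|\<close> times the indicator of the identity, and orthogonality shows that each
  simple character \<open>\<chi>\<close> occurs in it with multiplicity \<open>\<chi>(1)\<close>.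
\<close>

lemma regular_character_decomposition:
  obtains X where "finite X" "X \<subseteq> Collect simple_char"
    "\<And>g. g \<in> carrier G \<Longrightarrow> (\<Sum>\<chi>\<in>X. \<chi> \<one> * \<chi> g) = (if g = \<one> then of_nat (card (carrier G)) else 0)"
proof -
  define n where "n = card (carrier G)"
  have n: "n > 0" using finite_carrier by (auto simp: n_def card_gt_0_iff)
  obtain \<rho> where \<rho>: "is_rep n \<rho>"
    "\<And>g. g \<in> carrier G \<Longrightarrow> mat_trace (\<rho> g) = (if g = \<one> then of_nat n else 0)"
    using regular_rep unfolding n_def by blast
  obtain cs where cs: "set cs \<subseteq> Collect simple_char" "\<forall>g\<in>carrier G. mat_trace (\<rho> g) = (\<Sum>c\<leftarrow>cs. c g)"
    using rep_trace_eq_sum_simple_chars[OF \<rho>(1)] by blast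
  have reg: "(\<Sum>c\<in>set cs. of_nat (count_list cs c) * c g) = (if g = \<one> then of_nat n else 0)"
    if "g \<in> carrier G" for g
    using cs(2) \<rho>(2)[OF that] that sum_list_map_conv_sum_set[of "\<lambda>c. c g" cs] by simp
  have mult: "of_nat (count_list cs \<chi>) = \<chi> \<one>" if \<chi>: "\<chi> \<in> set cs" for \<chi>
  proof -
    have "of_nat n * \<chi> \<one> = (\<Sum>g\<in>carrier G. (if g = \<one> then of_nat n else 0) * \<chi> (inv g))"
      using finite_carrier by (simp add: if_distrib[of "\<lambda>x. x * _"] cong: if_cong)
    also have "\<dots> = (\<Sum>g\<in>carrier G. (\<Sum>c\<in>set cs. of_nat (count_list cs c) * c g) * \<chi> (inv g))"
      by (intro sum.cong refl) (simp add: reg)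
    also have "\<dots> = (\<Sum>c\<in>set cs. of_nat (count_list cs c) * (\<Sum>g\<in>carrier G. c g * \<chi> (inv g)))"
      by (simp add: sum_distrib_left sum_distrib_right mult.assoc sum.swap[of _ "carrier G"])
    also have "\<dots> = (\<Sum>c\<in>set cs. if c = \<chi> then of_nat (count_list cs c) * of_nat n else 0)"
    proof (intro sum.cong refl)
      fix c assume "c \<in> set cs"
      hence "simple_char c" "simple_char \<chi>" using cs(1) \<chi> by auto
      thus "of_nat (count_list cs c) * (\<Sum>g\<in>carrier G. c g * \<chi> (inv g)) =
          (if c = \<chi> then of_nat (count_list cs c) * of_nat n else 0)"
        by (simp add: simple_char_orthonormal n_def)
    qed
    also have "\<dots> = of_nat (count_list cs \<chi>) * of_nat n" using \<chi> by simp
    finally show ?thesis using n by simp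
  qed
  show thesis
  proof (rule that[of "set cs"])
    fix g assume g: "g \<in> carrier G"
    have "(\<Sum>\<chi>\<in>set cs. \<chi> \<one> * \<chi> g) = (\<Sum>c\<in>set cs. of_nat (count_list cs c) * c g)"
      by (intro sum.cong refl) (simp add: mult)
    thus "(\<Sum>\<chi>\<in>set cs. \<chi> \<one> * \<chi> g) = (if g = \<one> then of_nat (card (carrier G)) else 0)"
      using reg[OF g] by (simp add: n_def)
  qed (use cs in auto)
qed

section \<open>Degrees of simple characters divide the group order\<close>

lemma simple_char_sum_commutators:
  assumes \<chi>: "simple_char \<chi>" and h: "h \<in> carrier G"
  shows "(\<Sum>y\<in>carrier G. \<Sum>x\<in>carrier G. \<chi> (x \<otimes> y \<otimes> inv x \<otimes> inv y \<otimes> h)) =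
           (of_nat (card (carrier G)) / \<chi> \<one>)\<^sup>2 * \<chi> h"
proof -
  define k where "k = of_nat (card (carrier G)) / \<chi> \<one>"
  have "(\<Sum>y\<in>carrier G. \<Sum>x\<in>carrier G. \<chi> (x \<otimes> y \<otimes> inv x \<otimes> inv y \<otimes> h)) =
        (\<Sum>y\<in>carrier G. k * (\<chi> (\<one> \<otimes> y) * \<chi> (inv y \<otimes> h)))"
  proof (intro sum.cong refl)
    fix y assume y: "y \<in> carrier G"
    have "(\<Sum>x\<in>carrier G. \<chi> (x \<otimes> y \<otimes> inv x \<otimes> inv y \<otimes> h)) =
          (\<Sum>x\<in>carrier G. \<chi> ((inv y \<otimes> h) \<otimes> (x \<otimes> (y \<otimes> inv x))))"
    proof (intro sum.cong refl)
      fix x assume x: "x \<in> carrier G"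
      show "\<chi> (x \<otimes> y \<otimes> inv x \<otimes> inv y \<otimes> h) = \<chi> ((inv y \<otimes> h) \<otimes> (x \<otimes> (y \<otimes> inv x)))"
        using simple_char_comm[OF \<chi>, of "x \<otimes> (y \<otimes> inv x)" "inv y \<otimes> h"] x y h
        by (simp add: m_assoc)
    qed
    also have "\<dots> = k * (\<chi> (inv y \<otimes> h) * \<chi> y)"
      unfolding k_def using y h by (intro simple_char_sum_conj[OF \<chi>]) auto
    finally show "(\<Sum>x\<in>carrier G. \<chi> (x \<otimes> y \<otimes> inv x \<otimes> inv y \<otimes> h)) =
        k * (\<chi> (\<one> \<otimes> y) * \<chi> (inv y \<otimes> h))" using y by simp
  qed
  also have "\<dots> = k * (k * \<chi> (\<one> \<otimes> h))"
    unfolding sum_distrib_left[symmetric] k_def using h by (subst simple_char_sum_mult[OF \<chi>]) auto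
  finally show ?thesis using h by (simp add: k_def power2_eq_square)
qed

text \<open>
  By the preceding identity the values of \<open>\<chi>\<close> form an eigenvector, with eigenvalue \<open>(|G| / \<chi>(1))\<^sup>2\<close>,
  of the integer matrix whose entry at \<open>(i, j)\<close> counts the pairs \<open>(y, x)\<close> with \<open>x y x\<inverse> y\<inverse> e\<^sub>i = e\<^sub>j\<close>, where
  \<open>e\<^sub>0, e\<^sub>1, \<dots>\<close> enumerates the group. So this rational number is an integer.
\<close>

lemma simple_char_degree_dvd:
  assumes \<chi>: "simple_char \<chi>" and d: "\<chi> \<one> = of_nat d"
  shows "d dvd card (carrier G)"
proof -
  define n where "n = card (carrier G)"
  have n: "n > 0" using finite_carrier by (auto simp: n_def card_gt_0_iff)
  have d0: "d > 0" using simple_char_one[OF \<chi>] d by (metis of_nat_eq_iff)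
  obtain e where "bij_betw e {0..<n} (carrier G)"
    using ex_bij_betw_nat_finite[OF finite_carrier] unfolding n_def by blast
  hence e: "bij_betw e {..<n} (carrier G)" by (simp add: atLeast0LessThan)
  have eC: "e i \<in> carrier G" if "i < n" for i using e that by (auto simp: bij_betw_def)
  define c where "c i = (\<lambda>(y, x). x \<otimes> y \<otimes> inv x \<otimes> inv y \<otimes> e i)" for i
  have cC: "c i p \<in> carrier G" if "i < n" "p \<in> carrier G \<times> carrier G" for i p
    using that eC by (auto simp: c_def)
  define A where "A = mat n n (\<lambda>(i, j). int (card {p \<in> carrier G \<times> carrier G. c i p = e j}))"
  define v where "v = vec n (\<lambda>j. \<chi> (e j))"
  define k where "k = (of_nat n / of_nat d :: complex)\<^sup>2"
  have "eigenvector (map_mat of_int A) v k"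
    unfolding eigenvector_def
  proof (intro conjI)
    show "v \<in> carrier_vec (dim_row (map_mat of_int A))" by (simp add: v_def A_def)
    have "\<one> \<in> e ` {..<n}" using bij_betw_imp_surj_on[OF e] by simp
    then obtain j where j: "j < n" "\<one> = e j" by blast
    hence "v $ j \<noteq> 0" using d d0 by (simp add: v_def)
    thus "v \<noteq> 0\<^sub>v (dim_row (map_mat of_int A))" using j(1) by (auto simp: A_def)
    show "map_mat of_int A *\<^sub>v v = k \<cdot>\<^sub>v v"
    proof (rule eq_vecI)
      fix i assume "i < dim_vec (k \<cdot>\<^sub>v v)"
      hence i: "i < n" by (simp add: v_def)
      have "(map_mat of_int A *\<^sub>v v) $ i =
          (\<Sum>j<n. of_nat (card {p \<in> carrier G \<times> carrier G. c i p = e j}) * \<chi> (e j))"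
        using i by (simp add: A_def v_def scalar_prod_def atLeast0LessThan)
      also have "\<dots> = (\<Sum>g\<in>carrier G. of_nat (card {p \<in> carrier G \<times> carrier G. c i p = g}) * \<chi> g)"
        by (rule sum.reindex_bij_betw[OF e])
      also have "\<dots> = (\<Sum>g\<in>carrier G. \<Sum>p\<in>{p \<in> carrier G \<times> carrier G. c i p = g}. \<chi> (c i p))"
        by (intro sum.cong refl) simp
      also have "\<dots> = (\<Sum>p\<in>carrier G \<times> carrier G. \<chi> (c i p))"
        using finite_carrier cC[OF i] by (intro sum.group) auto
      also have "\<dots> = (\<Sum>y\<in>carrier G. \<Sum>x\<in>carrier G. \<chi> (x \<otimes> y \<otimes> inv x \<otimes> inv y \<otimes> e i))"
        by (simp add: sum.cartesian_product c_def case_prod_unfold)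
      also have "\<dots> = (k \<cdot>\<^sub>v v) $ i"
        using i by (simp add: simple_char_sum_commutators[OF \<chi> eC] k_def v_def n_def d)
      finally show "(map_mat of_int A *\<^sub>v v) $ i = (k \<cdot>\<^sub>v v) $ i" .
    qed (simp add: A_def v_def)
  qed
  hence "eigenvalue (map_mat of_int A) k" unfolding eigenvalue_def by blast
  moreover have "A \<in> carrier_mat n n" by (simp add: A_def)
  moreover have "k \<in> \<rat>" by (simp add: k_def)
  ultimately have "k \<in> \<int>" by (metis rational_eigenvalue_of_int_mat)
  then obtain z where z: "k = of_int z" by (auto elim: Ints_cases)
  hence "(of_nat n)\<^sup>2 = (of_int z * (of_nat d)\<^sup>2 :: complex)"
    using d0 by (simp add: k_def field_simps)
  hence "(of_int ((int n)\<^sup>2) :: complex) = of_int (z * (int d)\<^sup>2)" by simp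
  hence "(int n)\<^sup>2 = z * (int d)\<^sup>2" by (simp only: of_int_eq_iff)
  hence "(int d)\<^sup>2 dvd (int n)\<^sup>2" by simp
  thus ?thesis unfolding n_def by simp
qed

end

section \<open>Sums of simple characters over word values\<close>

lemma sum_PiE_insert:
  assumes "i \<notin> I"
  shows "(\<Sum>g\<in>insert i I \<rightarrow>\<^sub>E C. F g) = (\<Sum>g\<in>I \<rightarrow>\<^sub>E C. \<Sum>x\<in>C. F (g(i := x)))"
proof -
  have "(\<Sum>g\<in>insert i I \<rightarrow>\<^sub>E C. F g) = (\<Sum>(x, g)\<in>C \<times> (I \<rightarrow>\<^sub>E C). F (g(i := x)))"
    unfolding PiE_insert_eq using inj_combinator[OF assms, of "\<lambda>_. C"]
    by (subst sum.reindex) (simp_all add: case_prod_unfold)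
  also have "\<dots> = (\<Sum>x\<in>C. \<Sum>g\<in>I \<rightarrow>\<^sub>E C. F (g(i := x)))"
    by (simp add: sum.cartesian_product)
  also have "\<dots> = (\<Sum>g\<in>I \<rightarrow>\<^sub>E C. \<Sum>x\<in>C. F (g(i := x)))"
    by (rule sum.swap)
  finally show ?thesis .
qed

lemma count_indices_in: "count (indices_in i w) k = count (mset w) (i, k)"
  by (induction w) (auto simp: indices_in_def)

lemma admissible_mset:
  assumes w: "w \<in> free_group_words n" and adm: "admissible w"
  defines "J \<equiv> {i. occurs_in i w}"
  shows "J \<subseteq> {1..n}" and "mset w = mset_set (J \<times> {1, -1})"
proof -
  have nz: "i \<in> {1..n} \<and> k \<noteq> 0" if "(i, k) \<in> set w" for i k
    using w that by (auto simp: free_group_words_def)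
  thus J: "J \<subseteq> {1..n}" by (auto simp: J_def occurs_in_def)
  hence fin: "finite (J \<times> {1, -1 :: int})" using finite_subset by auto
  show "mset w = mset_set (J \<times> {1, -1})"
  proof (rule multiset_eqI)
    fix s :: "nat \<times> int"
    obtain i k where s: "s = (i, k)" by (cases s)
    show "count (mset w) s = count (mset_set (J \<times> {1, -1})) s"
    proof (cases "i \<in> J")
      case True
      hence "indices_in i w = {#1, -1#}" using adm by (simp add: J_def admissible_def)
      thus ?thesis using True fin
        unfolding s count_indices_in[symmetric] by (auto simp: count_mset_set')
    next
      case False
      hence "(i, k) \<notin> set w" using nz[of i k] by (auto simp: J_def occurs_in_def)
      thus ?thesis using False fin by (simp add: s count_mset_set' count_mset_0_iff)
    qed
  qed
qed

context finite_group
begin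

lemma word_value_closed: "(\<And>s. s \<in> set w \<Longrightarrow> g (fst s) \<in> carrier G) \<Longrightarrow> word_value G g w \<in> carrier G"
  by (induction w) (auto simp: word_value_def case_prod_unfold)

lemma word_value_append:
  assumes "\<And>s. s \<in> set u \<Longrightarrow> g (fst s) \<in> carrier G" "\<And>s. s \<in> set w \<Longrightarrow> g (fst s) \<in> carrier G"
  shows "word_value G g (u @ w) = word_value G g u \<otimes> word_value G g w"
  using assms(1)
proof (induction u)
  case Nil
  have "word_value G g w \<in> carrier G" using assms(2) by (rule word_value_closed)
  thus ?case by (simp add: word_value_def)
next
  case (Cons s u)
  have "word_value G g u \<in> carrier G" "word_value G g w \<in> carrier G"
    using Cons.prems assms(2) by (auto intro!: word_value_closed)
  moreover have "g (fst s) [^] snd s \<in> carrier G" using Cons.prems by simp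
  moreover have "word_value G g (u @ w) = word_value G g u \<otimes> word_value G g w"
    using Cons by auto
  ultimately show ?case by (simp add: word_value_def case_prod_unfold m_assoc)
qed

lemma word_value_Cons: "word_value G g (s # w) = g (fst s) [^] snd s \<otimes> word_value G g w"
  by (simp add: word_value_def case_prod_unfold)

lemma word_value_cong:
  "(\<And>s. s \<in> set w \<Longrightarrow> g (fst s) = g' (fst s)) \<Longrightarrow> word_value G g w = word_value G g' w"
  by (induction w) (auto simp: word_value_def case_prod_unfold)

lemma int_pow_minus_one: "x \<in> carrier G \<Longrightarrow> x [^] (-1 :: int) = inv x"
  using int_pow_neg[of x 1] int_pow_1[of x] by simp

text \<open>
  Summation over the value \<open>x\<close> of one generator. In a product of character values of a multiset of words
  in which the generator occurs once with exponent \<open>1\<close> and once with exponent \<open>-1\<close>, the sum splits the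
  word containing both letters into two words, or merges the two words containing one letter each:
  \<open>\<Sum>\<^sub>x \<chi>(u x v x\<inverse>) = |G| / \<chi>(1) \<cdot> \<chi>(u) \<chi>(v)\<close> and \<open>\<Sum>\<^sub>x \<chi>(u x) \<chi>(x\<inverse> v) = |G| / \<chi>(1) \<cdot> \<chi>(u v)\<close>.
  The new multiset of words does not depend on the values of the other generators.
\<close>

lemma word_char_sum_eliminate:
  assumes \<chi>: "simple_char \<chi>"
    and W: "(\<Sum>w\<in>#W. mset w) = add_mset (i, 1) (add_mset (i, -1) M)"
    and i: "\<And>s. s \<in># M \<Longrightarrow> fst s \<noteq> i"
  obtains W' where "(\<Sum>w\<in>#W'. mset w) = M"
    "\<And>g. (\<And>s. s \<in># M \<Longrightarrow> g (fst s) \<in> carrier G) \<Longrightarrow>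
       (\<Sum>x\<in>carrier G. \<Prod>w\<in>#W. \<chi> (word_value G (g(i := x)) w)) =
         of_nat (card (carrier G)) / \<chi> \<one> * (\<Prod>w\<in>#W'. \<chi> (word_value G g w))"
proof -
  have "(i, 1) \<in># (\<Sum>w\<in>#W. mset w)" by (simp add: W)
  then obtain w where "w \<in># W" "(i, 1) \<in> set w" by auto
  then obtain W1 a b where W1: "W = add_mset w W1" and w: "w = a @ (i, 1) # b"
    by (metis multi_member_split split_list)
  have M1: "mset (b @ a) + (\<Sum>w\<in>#W1. mset w) = add_mset (i, -1) M"
    using W by (simp add: W1 w ac_simps)
  have value_w: "\<chi> (word_value G (g(i := x)) w) = \<chi> (x \<otimes> word_value G (g(i := x)) (b @ a))"
    if x: "x \<in> carrier G" and g: "\<forall>s\<in>#M. g (fst s) \<in> carrier G" for g x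
  proof -
    define g' where "g' = g(i := x)"
    have *: "g' (fst s) \<in> carrier G" if "s \<in> set w" for s
    proof -
      have "s \<in># add_mset (i, 1) (add_mset (i, -1) M)"
        unfolding W[symmetric] W1 using that by simp
      hence "s = (i, 1) \<or> s = (i, -1) \<or> s \<in># M" by simp
      thus ?thesis using x bspec[OF g, of s] by (auto simp: g'_def)
    qed
    have C: "word_value G g' a \<in> carrier G" "word_value G g' b \<in> carrier G"
      by (rule word_value_closed, rule *, auto simp: w)+
    have "word_value G g' w = word_value G g' a \<otimes> word_value G g' ((i, 1) # b)"
      unfolding w by (rule word_value_append; rule *; auto simp: w)
    also have "word_value G g' ((i, 1) # b) = x \<otimes> word_value G g' b"
      using x by (simp add: word_value_Cons g'_def)
    finally have "\<chi> (word_value G g' w) = \<chi> (x \<otimes> (word_value G g' b \<otimes> word_value G g' a))"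
      using x C simple_char_comm[OF \<chi>, of "word_value G g' a" "x \<otimes> word_value G g' b"]
      by (simp add: m_assoc)
    also have "word_value G g' b \<otimes> word_value G g' a = word_value G g' (b @ a)"
      by (rule word_value_append[symmetric]; rule *; auto simp: w)
    finally show ?thesis by (simp only: g'_def)
  qed
  have split_inv: "word_value G (g(i := x)) (c @ (i, -1) # e) = word_value G g c \<otimes> (inv x \<otimes> word_value G g e)"
    if x: "x \<in> carrier G" and g: "\<forall>s\<in>#M. g (fst s) \<in> carrier G"
      and ce: "set c \<union> set e \<subseteq> set_mset M" for g x c e
  proof -
    define g' where "g' = g(i := x)"
    have *: "g' (fst s) \<in> carrier G" if "s \<in> set (c @ (i, -1) # e)" for s
    proof -
      have "s = (i, -1) \<or> s \<in># M" using that ce by auto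
      thus ?thesis using x bspec[OF g, of s] by (auto simp: g'_def)
    qed
    have "word_value G g' (c @ (i, -1) # e) = word_value G g' c \<otimes> word_value G g' ((i, -1) # e)"
      by (rule word_value_append; rule *; auto)
    moreover have "word_value G g' ((i, -1) # e) = inv x \<otimes> word_value G g' e"
      using x by (simp add: word_value_Cons g'_def int_pow_minus_one)
    moreover have neq: "fst s \<noteq> i" if "s \<in> set c \<union> set e" for s using i ce that by blast
    have "word_value G g' c = word_value G g c" "word_value G g' e = word_value G g e"
      by (rule word_value_cong, use neq in \<open>simp add: g'_def\<close>)+
    ultimately show ?thesis by (simp add: g'_def)
  qed
  have indep: "(\<Prod>w\<in>#V. \<chi> (word_value G (g(i := x)) w)) = (\<Prod>w\<in>#V. \<chi> (word_value G g w))"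
    if V: "\<And>w. w \<in># V \<Longrightarrow> set w \<subseteq> set_mset M" for V g x
  proof -
    have "word_value G (g(i := x)) w = word_value G g w" if "w \<in># V" for w
    proof (rule word_value_cong)
      fix s assume "s \<in> set w"
      hence "fst s \<noteq> i" using V[OF that] i by blast
      thus "(g(i := x)) (fst s) = g (fst s)" by simp
    qed
    thus ?thesis by (intro arg_cong[of _ _ prod_mset] image_mset_cong) simp
  qed
  show thesis
  proof (cases "(i, -1) \<in> set (b @ a)")
    case True
    then obtain c e where ce: "b @ a = c @ (i, -1) # e" by (meson split_list)
    have M: "mset c + mset e + (\<Sum>w\<in>#W1. mset w) = M" using M1 unfolding ce by simp
    show thesis
    proof (rule that[of "add_mset c (add_mset e W1)"])
      show "(\<Sum>w\<in>#add_mset c (add_mset e W1). mset w) = M" using M by (simp add: ac_simps)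
      fix g assume g: "\<And>s. s \<in># M \<Longrightarrow> g (fst s) \<in> carrier G"
      hence g': "\<forall>s\<in>#M. g (fst s) \<in> carrier G" by blast
      have sub: "set c \<union> set e \<subseteq> set_mset M" "\<And>w. w \<in># W1 \<Longrightarrow> set w \<subseteq> set_mset M"
        unfolding M[symmetric] by auto
      have ceC: "word_value G g c \<in> carrier G" "word_value G g e \<in> carrier G"
        by (rule word_value_closed, rule g, use sub(1) in blast)+
      have "(\<Sum>x\<in>carrier G. \<Prod>w\<in>#W. \<chi> (word_value G (g(i := x)) w)) =
            (\<Sum>x\<in>carrier G. \<chi> (word_value G g e \<otimes> (x \<otimes> (word_value G g c \<otimes> inv x)))) *
              (\<Prod>w\<in>#W1. \<chi> (word_value G g w))"
        unfolding sum_distrib_right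
      proof (intro sum.cong refl)
        fix x assume x: "x \<in> carrier G"
        have "\<chi> (word_value G (g(i := x)) w) = \<chi> (x \<otimes> (word_value G g c \<otimes> (inv x \<otimes> word_value G g e)))"
          using value_w[OF x g'] split_inv[OF x g' sub(1)] by (simp add: ce)
        also have "\<dots> = \<chi> (word_value G g e \<otimes> (x \<otimes> (word_value G g c \<otimes> inv x)))"
          using simple_char_comm[OF \<chi>, of "x \<otimes> (word_value G g c \<otimes> inv x)" "word_value G g e"] x ceC
          by (simp add: m_assoc)
        finally show "(\<Prod>w\<in>#W. \<chi> (word_value G (g(i := x)) w)) =
            \<chi> (word_value G g e \<otimes> (x \<otimes> (word_value G g c \<otimes> inv x))) * (\<Prod>w\<in>#W1. \<chi> (word_value G g w))"
          by (simp add: W1 indep[OF sub(2)])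
      qed
      also have "\<dots> = of_nat (card (carrier G)) / \<chi> \<one> *
          (\<Prod>w\<in>#add_mset c (add_mset e W1). \<chi> (word_value G g w))"
        by (simp add: simple_char_sum_conj[OF \<chi> ceC(2,1)])
      finally show "(\<Sum>x\<in>carrier G. \<Prod>w\<in>#W. \<chi> (word_value G (g(i := x)) w)) =
          of_nat (card (carrier G)) / \<chi> \<one> * (\<Prod>w\<in>#add_mset c (add_mset e W1). \<chi> (word_value G g w))" .
    qed
  next
    case False
    have "(i, -1) \<in># mset (b @ a) + (\<Sum>w\<in>#W1. mset w)" unfolding M1 by simp
    hence "(i, -1) \<in># (\<Sum>w\<in>#W1. mset w)" using False by auto
    then obtain w' where "w' \<in># W1" "(i, -1) \<in> set w'" by auto
    then obtain W2 c e where W2: "W1 = add_mset w' W2" and w': "w' = c @ (i, -1) # e"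
      by (metis multi_member_split split_list)
    have M: "mset (b @ a) + mset c + mset e + (\<Sum>w\<in>#W2. mset w) = M"
      using M1 unfolding W2 w' by (simp add: ac_simps)
    show thesis
    proof (rule that[of "add_mset ((b @ a) @ (e @ c)) W2"])
      show "(\<Sum>w\<in>#add_mset ((b @ a) @ (e @ c)) W2. mset w) = M" using M by (simp add: ac_simps)
      fix g assume g: "\<And>s. s \<in># M \<Longrightarrow> g (fst s) \<in> carrier G"
      hence g': "\<forall>s\<in>#M. g (fst s) \<in> carrier G" by blast
      have sub: "set c \<union> set e \<subseteq> set_mset M" "\<And>w. w \<in># W2 \<Longrightarrow> set w \<subseteq> set_mset M"
        "set (b @ a) \<subseteq> set_mset M"
        unfolding M[symmetric] by auto
      have gC: "g (fst s) \<in> carrier G" if "s \<in> set (b @ a) \<union> set c \<union> set e" for s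
        using that g sub(1,3) by blast
      have ceC: "word_value G g c \<in> carrier G" "word_value G g e \<in> carrier G"
        "word_value G g (b @ a) \<in> carrier G"
        by (rule word_value_closed, rule gC, auto)+
      have ec: "word_value G g (e @ c) = word_value G g e \<otimes> word_value G g c"
        "word_value G g ((b @ a) @ (e @ c)) = word_value G g (b @ a) \<otimes> word_value G g (e @ c)"
        by (rule word_value_append; rule gC; auto)+
      have ecC: "word_value G g (e @ c) \<in> carrier G" using ceC ec by simp
      have "(\<Sum>x\<in>carrier G. \<Prod>w\<in>#W. \<chi> (word_value G (g(i := x)) w)) =
            (\<Sum>x\<in>carrier G. \<chi> (word_value G g (b @ a) \<otimes> x) * \<chi> (inv x \<otimes> word_value G g (e @ c))) *
              (\<Prod>w\<in>#W2. \<chi> (word_value G g w))"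
        unfolding sum_distrib_right
      proof (intro sum.cong refl)
        fix x assume x: "x \<in> carrier G"
        have "word_value G (g(i := x)) (b @ a) = word_value G g (b @ a)"
        proof (rule word_value_cong)
          fix s assume "s \<in> set (b @ a)"
          hence "fst s \<noteq> i" using sub(3) i by blast
          thus "(g(i := x)) (fst s) = g (fst s)" by simp
        qed
        hence 1: "\<chi> (word_value G (g(i := x)) w) = \<chi> (word_value G g (b @ a) \<otimes> x)"
          using value_w[OF x g'] simple_char_comm[OF \<chi> x ceC(3)] by simp
        have "\<chi> (word_value G (g(i := x)) w') = \<chi> (word_value G g c \<otimes> (inv x \<otimes> word_value G g e))"
          using split_inv[OF x g' sub(1)] by (simp add: w')
        also have "\<dots> = \<chi> (inv x \<otimes> word_value G g (e @ c))"
          using simple_char_comm[OF \<chi>, of "word_value G g c" "inv x \<otimes> word_value G g e"] x ceC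
          by (simp add: m_assoc ec)
        finally show "(\<Prod>w\<in>#W. \<chi> (word_value G (g(i := x)) w)) =
            \<chi> (word_value G g (b @ a) \<otimes> x) * \<chi> (inv x \<otimes> word_value G g (e @ c)) *
              (\<Prod>w\<in>#W2. \<chi> (word_value G g w))"
          by (simp add: W1 W2 indep[OF sub(2)] 1 mult.assoc del: append_assoc)
      qed
      also have "\<dots> = of_nat (card (carrier G)) / \<chi> \<one> *
          (\<Prod>w\<in>#add_mset ((b @ a) @ (e @ c)) W2. \<chi> (word_value G g w))"
        by (simp add: simple_char_sum_mult[OF \<chi> ceC(3) ecC] ec(2) del: append_assoc)
      finally show "(\<Sum>x\<in>carrier G. \<Prod>w\<in>#W. \<chi> (word_value G (g(i := x)) w)) =
          of_nat (card (carrier G)) / \<chi> \<one> * (\<Prod>w\<in>#add_mset ((b @ a) @ (e @ c)) W2. \<chi> (word_value G g w))" .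
    qed
  qed
qed

text \<open>
  Iterated elimination of all generators. The index \<open>0\<close> is not a generator but carries the fixed
  group element \<open>h\<close>; in the end only this letter and some number \<open>v\<close> of empty words are left. The
  exponent \<open>a\<close> arises as the number of generators that occur; the others each contribute a factor \<open>|G|\<close>.
\<close>

lemma word_char_sum:
  assumes \<chi>: "simple_char \<chi>" and "finite I" and "0 \<notin> I"
  shows "J \<subseteq> I \<Longrightarrow> (\<Sum>w\<in>#W. mset w) = add_mset (0, 1) (mset_set (J \<times> {1, -1})) \<Longrightarrow>
    \<exists>a v. a \<le> card I \<and> (\<forall>h\<in>carrier G.
      (\<Sum>g\<in>I \<rightarrow>\<^sub>E carrier G. \<Prod>w\<in>#W. \<chi> (word_value G (g(0 := h)) w)) =
        of_nat (card (carrier G)) ^ card I * \<chi> \<one> ^ v / \<chi> \<one> ^ a * \<chi> h)"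
  using assms(2,3)
proof (induction I arbitrary: J W rule: finite_induct)
  case empty
  hence W: "(\<Sum>w\<in>#W. mset w) = {#(0, 1)#}" by simp
  hence "(0, 1) \<in># (\<Sum>w\<in>#W. mset w)" by simp
  then obtain w where "w \<in># W" "(0, 1) \<in> set w" by auto
  then obtain W1 where W1: "W = add_mset w W1" by (metis multi_member_split)
  have "mset w + (\<Sum>w\<in>#W1. mset w) = {#(0, 1)#}" using W by (simp add: W1)
  with \<open>(0, 1) \<in> set w\<close> have w: "mset w = {#(0, 1)#}" and W1': "(\<Sum>w\<in>#W1. mset w) = {#}"
    by (auto simp: union_is_single)
  have w_eq: "w = [(0, 1)]" using w by simp
  have W1_empty: "u = []" if "u \<in># W1" for u
  proof -
    have "mset u \<subseteq># (\<Sum>w\<in>#W1. mset w)" using that by (metis multi_member_split image_mset_add_mset sum_mset.add_mset mset_subset_eq_add_left)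
    thus ?thesis by (simp add: W1')
  qed
  have "(\<Prod>w\<in>#W. \<chi> (word_value G (g(0 := h)) w)) = \<chi> \<one> ^ size W1 * \<chi> h" if h: "h \<in> carrier G" for g h
  proof -
    have "image_mset (\<lambda>w. \<chi> (word_value G (g(0 := h)) w)) W1 = image_mset (\<lambda>_. \<chi> \<one>) W1"
    proof (rule image_mset_cong)
      fix u assume "u \<in># W1"
      from W1_empty[OF this] show "\<chi> (word_value G (g(0 := h)) u) = \<chi> \<one>"
        by (simp add: word_value_def)
    qed
    thus ?thesis using h by (simp add: W1 w_eq word_value_def image_mset_const_eq)
  qed
  hence "\<forall>h\<in>carrier G. (\<Sum>g\<in>{} \<rightarrow>\<^sub>E carrier G. \<Prod>w\<in>#W. \<chi> (word_value G (g(0 := h)) w)) =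
      of_nat (card (carrier G)) ^ card {} * \<chi> \<one> ^ size W1 / \<chi> \<one> ^ 0 * \<chi> h"
    by (simp only: PiE_empty_domain sum.insert finite.emptyI empty_iff not_False_eq_True sum.empty
          add_0_right card.empty power_0 mult_1 div_by_1) blast
  thus ?case by (metis le0)
next
  case (insert i I)
  define n where "n = (of_nat (card (carrier G)) :: complex)"
  have i: "i \<noteq> 0" "0 \<notin> I" using insert.prems by auto
  have upd: "(g(i := x))(0 := h) = (g(0 := h))(i := x)" for g :: "nat \<Rightarrow> 'a" and x h
    using i by (simp add: fun_upd_twist)
  show ?case
  proof (cases "i \<in> J")
    case False
    hence J: "J \<subseteq> I" using insert.prems by auto
    obtain a v where av: "a \<le> card I" "\<forall>h\<in>carrier G.
        (\<Sum>g\<in>I \<rightarrow>\<^sub>E carrier G. \<Prod>w\<in>#W. \<chi> (word_value G (g(0 := h)) w)) = n ^ card I * \<chi> \<one> ^ v / \<chi> \<one> ^ a * \<chi> h"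
      using insert.IH[OF J insert.prems(2) i(2)] unfolding n_def by blast
    have fin: "finite (J \<times> {1, -1 :: int})" using J insert.hyps finite_subset by auto
    have "(\<Prod>w\<in>#W. \<chi> (word_value G ((g(i := x))(0 := h)) w)) = (\<Prod>w\<in>#W. \<chi> (word_value G (g(0 := h)) w))" for g x h
    proof -
      have "word_value G ((g(i := x))(0 := h)) w = word_value G (g(0 := h)) w" if w: "w \<in># W" for w
      proof (rule word_value_cong)
        fix s assume "s \<in> set w"
        hence "s \<in># (\<Sum>w\<in>#W. mset w)" using w by auto
        hence "fst s \<noteq> i" using fin False i unfolding insert.prems(2) by auto
        thus "((g(i := x))(0 := h)) (fst s) = (g(0 := h)) (fst s)" by simp
      qed
      thus ?thesis by (intro arg_cong[of _ _ prod_mset] image_mset_cong) simp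
    qed
    hence eq: "(\<Sum>g\<in>insert i I \<rightarrow>\<^sub>E carrier G. \<Prod>w\<in>#W. \<chi> (word_value G (g(0 := h)) w)) =
        n * (\<Sum>g\<in>I \<rightarrow>\<^sub>E carrier G. \<Prod>w\<in>#W. \<chi> (word_value G (g(0 := h)) w))" for h
      by (simp add: sum_PiE_insert[OF insert.hyps(2)] sum_distrib_left n_def)
    have "\<forall>h\<in>carrier G. (\<Sum>g\<in>insert i I \<rightarrow>\<^sub>E carrier G. \<Prod>w\<in>#W. \<chi> (word_value G (g(0 := h)) w)) =
        n ^ card (insert i I) * \<chi> \<one> ^ v / \<chi> \<one> ^ a * \<chi> h"
    proof
      fix h assume h: "h \<in> carrier G"
      show "(\<Sum>g\<in>insert i I \<rightarrow>\<^sub>E carrier G. \<Prod>w\<in>#W. \<chi> (word_value G (g(0 := h)) w)) =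
        n ^ card (insert i I) * \<chi> \<one> ^ v / \<chi> \<one> ^ a * \<chi> h"
        unfolding eq bspec[OF av(2) h] using insert.hyps by simp
    qed
    with av(1) insert.hyps show ?thesis
      unfolding n_def[symmetric] by - (rule exI[of _ "a"], rule exI[of _ v], rule conjI, simp, assumption)
  next
    case True
    define J' where "J' = J - {i}"
    have J': "J' \<subseteq> I" using insert.prems by (auto simp: J'_def)
    have finJ: "finite J'" using J' insert.hyps finite_subset by auto
    define M where "M = add_mset (0 :: nat, 1 :: int) (mset_set (J' \<times> {1, -1}))"
    have "J \<times> {1, -1} = insert (i, 1) (insert (i, -1) (J' \<times> {1, -1 :: int}))"
      using True by (auto simp: J'_def)
    moreover have "(i, 1) \<notin> insert (i, -1) (J' \<times> {1, -1 :: int})" "(i, -1) \<notin> J' \<times> {1, -1 :: int}"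
      by (auto simp: J'_def)
    ultimately have W: "(\<Sum>w\<in>#W. mset w) = add_mset (i, 1) (add_mset (i, -1) M)"
      using finJ insert.prems(2) by (simp add: M_def add_mset_commute)
    have M: "fst s \<in> insert 0 J'" if "s \<in># M" for s
      using that finJ by (auto simp: M_def)
    have "fst s \<noteq> i" if "s \<in># M" for s using M[OF that] i by (auto simp: J'_def)
    then obtain W' where W': "(\<Sum>w\<in>#W'. mset w) = M"
      and elim: "\<And>g. (\<And>s. s \<in># M \<Longrightarrow> g (fst s) \<in> carrier G) \<Longrightarrow>
       (\<Sum>x\<in>carrier G. \<Prod>w\<in>#W. \<chi> (word_value G (g(i := x)) w)) =
         n / \<chi> \<one> * (\<Prod>w\<in>#W'. \<chi> (word_value G g w))"
      using word_char_sum_eliminate[OF \<chi> W] unfolding n_def by blast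
    obtain a v where av: "a \<le> card I" "\<forall>h\<in>carrier G.
        (\<Sum>g\<in>I \<rightarrow>\<^sub>E carrier G. \<Prod>w\<in>#W'. \<chi> (word_value G (g(0 := h)) w)) = n ^ card I * \<chi> \<one> ^ v / \<chi> \<one> ^ a * \<chi> h"
      using insert.IH[OF J' W'[unfolded M_def] i(2)] unfolding n_def by blast
    have eq: "(\<Sum>g\<in>insert i I \<rightarrow>\<^sub>E carrier G. \<Prod>w\<in>#W. \<chi> (word_value G (g(0 := h)) w)) =
        n / \<chi> \<one> * (\<Sum>g\<in>I \<rightarrow>\<^sub>E carrier G. \<Prod>w\<in>#W'. \<chi> (word_value G (g(0 := h)) w))" if h: "h \<in> carrier G" for h
      unfolding sum_PiE_insert[OF insert.hyps(2)] sum_distrib_left upd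
    proof (intro sum.cong refl elim)
      fix g s assume g: "g \<in> I \<rightarrow>\<^sub>E carrier G" and s: "s \<in># M"
      show "(g(0 := h)) (fst s) \<in> carrier G" using M[OF s] J' h PiE_mem[OF g] by auto
    qed
    have "\<forall>h\<in>carrier G. (\<Sum>g\<in>insert i I \<rightarrow>\<^sub>E carrier G. \<Prod>w\<in>#W. \<chi> (word_value G (g(0 := h)) w)) =
        n ^ card (insert i I) * \<chi> \<one> ^ v / \<chi> \<one> ^ (Suc a) * \<chi> h"
    proof
      fix h assume h: "h \<in> carrier G"
      show "(\<Sum>g\<in>insert i I \<rightarrow>\<^sub>E carrier G. \<Prod>w\<in>#W. \<chi> (word_value G (g(0 := h)) w)) =
        n ^ card (insert i I) * \<chi> \<one> ^ v / \<chi> \<one> ^ (Suc a) * \<chi> h"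
        unfolding eq[OF h] bspec[OF av(2) h] using insert.hyps by simp
    qed
    with av(1) insert.hyps show ?thesis
      unfolding n_def[symmetric] by - (rule exI[of _ "Suc a"], rule exI[of _ v], rule conjI, simp, assumption)
  qed
qed

text \<open>
  Here \<open>d\<close> is the degree of a simple character and \<open>N\<close> the order of the group. At most \<open>n\<close> factors \<open>d\<close>
  in the denominator are balanced by the extra factor \<open>d\<close> and by all but one of the factors \<open>N\<close>.
\<close>

lemma multiplicity_of_nat:
  fixes N d n a v :: nat
  assumes "d dvd N" "d > 0" "n \<ge> 1" "a \<le> n"
  shows "\<exists>m. of_nat d * (of_nat N ^ n * of_nat d ^ v / of_nat d ^ a) = (of_nat N * of_nat m :: complex)"
proof (cases a)
  case 0
  have "(of_nat N :: complex) ^ n = of_nat N * of_nat N ^ (n - 1)"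
    using assms(3) by (cases n) auto
  thus ?thesis using 0 by (intro exI[of _ "d * N ^ (n - 1) * d ^ v"]) simp
next
  case (Suc b)
  obtain q where q: "N = d * q" using assms(1) by blast
  have "n = Suc b + (n - a)" using Suc assms(4) by simp
  hence "(of_nat N :: complex) ^ n = of_nat N * of_nat N ^ b * of_nat N ^ (n - a)"
    by (metis power_Suc power_add)
  also have "(of_nat N :: complex) ^ b = of_nat d ^ b * of_nat q ^ b" by (simp add: q power_mult_distrib)
  finally show ?thesis using Suc assms(2)
    by (intro exI[of _ "q ^ b * N ^ (n - a) * d ^ v"]) (simp add: field_simps)
qed

end

section \<open>Solutions of admissible word equations\<close>

theorem theorem3p1p4:
  fixes G :: "('a, 'b) monoid_scheme" and n :: nat and \<omega> :: syllable_word
  assumes "n \<ge> 1"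
    and "\<omega> \<in> free_group_words n"
    and "admissible \<omega>"
    and "group G"
    and "finite (carrier G)"
  shows "is_character G (zeta G n \<omega>)"
proof -
  interpret finite_group G
    using assms(4,5) by (simp add: finite_group_def finite_group_axioms_def)
  define N where "N = card (carrier G)"
  have N: "N > 0" using finite_carrier by (auto simp: N_def card_gt_0_iff)
  define J where "J = {i. occurs_in i \<omega>}"
  have J: "J \<subseteq> {1..n}" "mset \<omega> = mset_set (J \<times> {1, -1})"
    unfolding J_def using admissible_mset[OF assms(2,3)] by auto
  obtain X where X: "finite X" "X \<subseteq> Collect simple_char"
    and reg: "\<And>g. g \<in> carrier G \<Longrightarrow> (\<Sum>\<chi>\<in>X. \<chi> \<one>\<^bsub>G\<^esub> * \<chi> g) = (if g = \<one>\<^bsub>G\<^esub> then of_nat N else 0)"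
    using regular_character_decomposition unfolding N_def by blast
  \<comment> \<open>The factor \<open>N\<close> split off here cancels against the value \<open>N\<close> of the regular character at the
    identity, leaving the natural number \<open>m\<close> as multiplicity.\<close>
  have "\<exists>m. \<forall>h\<in>carrier G. \<chi> \<one>\<^bsub>G\<^esub> * (\<Sum>g\<in>{1..n} \<rightarrow>\<^sub>E carrier G. \<chi> (h \<otimes>\<^bsub>G\<^esub> word_value G g \<omega>)) =
      of_nat N * of_nat m * \<chi> h" if "\<chi> \<in> X" for \<chi>
  proof -
    have \<chi>: "simple_char \<chi>" using X that by auto
    obtain d where d: "d > 0" "\<chi> \<one>\<^bsub>G\<^esub> = of_nat d" using simple_char_one[OF \<chi>] .
    \<comment> \<open>The word \<open>\<omega>\<close> is preceded by the letter \<open>(0, 1)\<close>, which stands for the constant \<open>h\<close>.\<close>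
    have "(\<Sum>w\<in>#{#(0, 1) # \<omega>#}. mset w) = add_mset (0, 1) (mset_set (J \<times> {1, -1}))"
      by (simp add: J)
    then obtain a v where av: "a \<le> n" "\<forall>h\<in>carrier G.
        (\<Sum>g\<in>{1..n} \<rightarrow>\<^sub>E carrier G. \<Prod>w\<in>#{#(0, 1) # \<omega>#}. \<chi> (word_value G (g(0 := h)) w)) =
          of_nat N ^ n * of_nat d ^ v / of_nat d ^ a * \<chi> h"
      using word_char_sum[OF \<chi> _ _ J(1), of "{#(0, 1) # \<omega>#}"] by (auto simp: N_def d(2))
    obtain m where m: "of_nat d * (of_nat N ^ n * of_nat d ^ v / of_nat d ^ a) = (of_nat N * of_nat m :: complex)"
      using multiplicity_of_nat[OF simple_char_degree_dvd[OF \<chi> d(2)] d(1) assms(1) av(1)]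
      unfolding N_def by blast
    have "word_value G (g(0 := h)) ((0, 1) # \<omega>) = h \<otimes>\<^bsub>G\<^esub> word_value G g \<omega>" if "h \<in> carrier G" for g h
    proof -
      have "word_value G (g(0 := h)) \<omega> = word_value G g \<omega>"
        using assms(2) by (intro word_value_cong) (auto simp: free_group_words_def)
      thus ?thesis using that by (simp add: word_value_Cons)
    qed
    with av(2) have "\<forall>h\<in>carrier G. (\<Sum>g\<in>{1..n} \<rightarrow>\<^sub>E carrier G. \<chi> (h \<otimes>\<^bsub>G\<^esub> word_value G g \<omega>)) =
        of_nat N ^ n * of_nat d ^ v / of_nat d ^ a * \<chi> h" by simp
    with m show ?thesis unfolding d(2) by (metis mult.assoc)
  qed
  then obtain m where m: "\<And>\<chi> h. \<chi> \<in> X \<Longrightarrow> h \<in> carrier G \<Longrightarrow>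
      \<chi> \<one>\<^bsub>G\<^esub> * (\<Sum>g\<in>{1..n} \<rightarrow>\<^sub>E carrier G. \<chi> (h \<otimes>\<^bsub>G\<^esub> word_value G g \<omega>)) = of_nat N * of_nat (m \<chi>) * \<chi> h"
    by metis
  have wC: "word_value G g \<omega> \<in> carrier G" if "g \<in> {1..n} \<rightarrow>\<^sub>E carrier G" for g
  proof (rule word_value_closed)
    fix s assume "s \<in> set \<omega>"
    hence "fst s \<in> {1..n}" using assms(2) by (auto simp: free_group_words_def)
    thus "g (fst s) \<in> carrier G" by (rule PiE_mem[OF that])
  qed
  have fin: "finite ({1..n} \<rightarrow>\<^sub>E carrier G)" using finite_carrier by (intro finite_PiE) auto
  have "zeta G n \<omega> h = (\<Sum>\<chi>\<in>X. of_nat (m \<chi>) * \<chi> (inv\<^bsub>G\<^esub> h))" if h: "h \<in> carrier G" for h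
  proof -
    have "of_nat N * zeta G n \<omega> h = (\<Sum>g\<in>{1..n} \<rightarrow>\<^sub>E carrier G. if word_value G g \<omega> = h then of_nat N else 0)"
      using fin by (simp add: zeta_def sum.If_cases Int_def mult.commute)
    also have "\<dots> = (\<Sum>g\<in>{1..n} \<rightarrow>\<^sub>E carrier G. \<Sum>\<chi>\<in>X. \<chi> \<one>\<^bsub>G\<^esub> * \<chi> (inv\<^bsub>G\<^esub> h \<otimes>\<^bsub>G\<^esub> word_value G g \<omega>))"
    proof (intro sum.cong refl)
      fix g assume "g \<in> {1..n} \<rightarrow>\<^sub>E carrier G"
      hence w: "word_value G g \<omega> \<in> carrier G" by (rule wC)
      have "inv\<^bsub>G\<^esub> h \<otimes>\<^bsub>G\<^esub> word_value G g \<omega> = \<one>\<^bsub>G\<^esub> \<longleftrightarrow> word_value G g \<omega> = h"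
        using h w by (metis inv_solve_left' l_inv r_one one_closed)
      thus "(if word_value G g \<omega> = h then of_nat N else 0) =
          (\<Sum>\<chi>\<in>X. \<chi> \<one>\<^bsub>G\<^esub> * \<chi> (inv\<^bsub>G\<^esub> h \<otimes>\<^bsub>G\<^esub> word_value G g \<omega>))"
        using reg[of "inv\<^bsub>G\<^esub> h \<otimes>\<^bsub>G\<^esub> word_value G g \<omega>"] h w by simp
    qed
    also have "\<dots> = (\<Sum>\<chi>\<in>X. \<chi> \<one>\<^bsub>G\<^esub> * (\<Sum>g\<in>{1..n} \<rightarrow>\<^sub>E carrier G. \<chi> (inv\<^bsub>G\<^esub> h \<otimes>\<^bsub>G\<^esub> word_value G g \<omega>)))"
      unfolding sum_distrib_left by (rule sum.swap)
    also have "\<dots> = (\<Sum>\<chi>\<in>X. of_nat N * of_nat (m \<chi>) * \<chi> (inv\<^bsub>G\<^esub> h))"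
      using h by (intro sum.cong refl m) auto
    also have "\<dots> = of_nat N * (\<Sum>\<chi>\<in>X. of_nat (m \<chi>) * \<chi> (inv\<^bsub>G\<^esub> h))"
      by (simp add: sum_distrib_left mult.assoc)
    finally show ?thesis using N by simp
  qed
  moreover have "is_character G (\<lambda>h. \<Sum>\<chi>\<in>X. of_nat (m \<chi>) * \<chi> (inv\<^bsub>G\<^esub> h))"
    using X by (intro is_character_sum is_character_of_nat_mult is_character_inv simple_char_is_character) auto
  ultimately show ?thesis
    by (simp only: is_character_cong[of "zeta G n \<omega>" "\<lambda>h. \<Sum>\<chi>\<in>X. of_nat (m \<chi>) * \<chi> (inv\<^bsub>G\<^esub> h)"])
qed

end
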